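(* For every $n = 6+2\ell$ with $\ell$ a non-negative integer, there exists a non-homotopic $3$-colorable $1$-plane drawing of a multigraph on $n$ vertices with $5(n-2)$ edges and $4(n-2)$ crossings.
   Context: Drawings are in the plane: vertices are represented by points and edges by simple Jordan curves joining their endpoints. Edges cross only in internal points, do not share infinitely many points, do not touch, do not self-intersect, no more than two edges cross in a common point, and adjacent edges do not cross. Graphs may have parallel edges but no loops. A drawing is non-homotopic if every region whose boundary forms a lens, i.e. is formed by (parts of) exactly two edges, contains a vertex or a crossing in its interior. A drawing $\Gamma$ of a graph $G$ is $t$-colorable $k$-plane if there is a (not necessarily proper) edge-coloring $\varphi\colon E(G)\to\{1,\dots,t\}$ such that each edge is crossed in $\Gamma$ by at most $k$ edges of each of the $t$ colors. *)

theory Defs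
  imports "HOL-Analysis.Analysis"
begin

section \<open>Loopless multigraphs\<close>

text \<open>Undirected: an edge has a two-element set of endpoints, which excludes loops.
  Distinct edges with the same endpoint set are parallel edges.\<close>

record ('v, 'e) multigraph =
  verts :: "'v set"
  edges :: "'e set"
  ends  :: "'e \<Rightarrow> 'v set"

definition wf_multigraph :: "('v, 'e) multigraph \<Rightarrow> bool" where
  "wf_multigraph G \<longleftrightarrow>
     finite (verts G) \<and> finite (edges G) \<and>
     (\<forall>e\<in>edges G. ends G e \<subseteq> verts G \<and> card (ends G e) = 2)"


section \<open>Drawings in the plane\<close>

record ('v, 'e) drawing =
  point :: "'v \<Rightarrow> complex"
  curve :: "'e \<Rightarrow> real \<Rightarrow> complex"

abbreviation edge_image :: "('v, 'e) drawing \<Rightarrow> 'e \<Rightarrow> complex set" where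
  "edge_image D e \<equiv> path_image (curve D e)"

definition edge_inner :: "('v, 'e) drawing \<Rightarrow> 'e \<Rightarrow> complex set" where
  "edge_inner D e = edge_image D e - {pathstart (curve D e), pathfinish (curve D e)}"

text \<open>\<open>A\<close> and \<open>B\<close> cross (rather than touch) at \<open>p\<close> if, up to a homeomorphism of a
  neighbourhood of \<open>p\<close>, they look like the two coordinate axes near the origin.\<close>

definition crosses_at :: "complex set \<Rightarrow> complex set \<Rightarrow> complex \<Rightarrow> bool" where
  "crosses_at A B p \<longleftrightarrow>
     (\<exists>U h h'. open U \<and> p \<in> U \<and> homeomorphism U (ball 0 1) h h' \<and> h p = 0 \<and>
        h ` (A \<inter> U) = {z \<in> ball 0 1. Im z = 0} \<and>
        h ` (B \<inter> U) = {z \<in> ball 0 1. Re z = 0})"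

definition crossing_points :: "('v, 'e) drawing \<Rightarrow> 'e \<Rightarrow> 'e \<Rightarrow> complex set" where
  "crossing_points D e f =
     {p \<in> edge_inner D e \<inter> edge_inner D f. crosses_at (edge_image D e) (edge_image D f) p}"

definition is_drawing :: "('v, 'e) multigraph \<Rightarrow> ('v, 'e) drawing \<Rightarrow> bool" where
  "is_drawing G D \<longleftrightarrow>
     inj_on (point D) (verts G) \<and>
     \<comment> \<open>edges are simple curves joining their endpoints and avoiding all other vertices\<close>
     (\<forall>e\<in>edges G. arc (curve D e) \<and>
        {pathstart (curve D e), pathfinish (curve D e)} = point D ` ends G e \<and>
        edge_inner D e \<inter> point D ` verts G = {}) \<and>
     (\<forall>e\<in>edges G. \<forall>f\<in>edges G. e \<noteq> f \<longrightarrow>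
        finite (edge_image D e \<inter> edge_image D f) \<and>
        \<comment> \<open>no touching\<close>
        edge_inner D e \<inter> edge_inner D f \<subseteq> crossing_points D e f \<and>
        \<comment> \<open>adjacent (in particular parallel) edges do not cross\<close>
        (ends G e \<inter> ends G f \<noteq> {} \<longrightarrow> edge_inner D e \<inter> edge_inner D f = {})) \<and>
     \<comment> \<open>at most two edges cross in a common point\<close>
     (\<forall>e\<in>edges G. \<forall>f\<in>edges G. \<forall>g\<in>edges G. e \<noteq> f \<and> f \<noteq> g \<and> e \<noteq> g \<longrightarrow>
        edge_inner D e \<inter> edge_inner D f \<inter> edge_inner D g = {})"

text \<open>In a drawing every crossing point belongs to exactly one pair of edges, so the
  cardinality of this set is the number of crossings.\<close>

definition crossings :: "('v, 'e) multigraph \<Rightarrow> ('v, 'e) drawing \<Rightarrow> complex set" where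
  "crossings G D = (\<Union>e\<in>edges G. \<Union>f\<in>edges G - {e}. crossing_points D e f)"


section \<open>Non-homotopic and edge-colored drawings\<close>

text \<open>A region whose boundary is a closed Jordan curve formed by parts of the two edges
  \<open>e\<close> and \<open>f\<close>. Since an edge is an arc, the boundary cannot lie on one of them alone.
  Both sides of such a curve, hence also the unbounded one, are regions.\<close>

definition lens_region :: "('v, 'e) drawing \<Rightarrow> 'e \<Rightarrow> 'e \<Rightarrow> complex set \<Rightarrow> bool" where
  "lens_region D e f R \<longleftrightarrow>
     open R \<and> connected R \<and> R \<noteq> {} \<and>
     (\<exists>c. simple_path c \<and> pathfinish c = pathstart c \<and> path_image c = frontier R) \<and>
     frontier R \<subseteq> edge_image D e \<union> edge_image D f"

definition non_homotopic :: "('v, 'e) multigraph \<Rightarrow> ('v, 'e) drawing \<Rightarrow> bool" where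
  "non_homotopic G D \<longleftrightarrow>
     (\<forall>e\<in>edges G. \<forall>f\<in>edges G. \<forall>R. e \<noteq> f \<and> lens_region D e f R \<longrightarrow>
        R \<inter> (point D ` verts G \<union> crossings G D) \<noteq> {})"

text \<open>What is bounded is the number of crossing edges, not of crossing points.\<close>

definition colorable_plane ::
    "nat \<Rightarrow> nat \<Rightarrow> ('v, 'e) multigraph \<Rightarrow> ('v, 'e) drawing \<Rightarrow> bool" where
  "colorable_plane t k G D \<longleftrightarrow>
     (\<exists>\<phi> :: 'e \<Rightarrow> nat. \<phi> ` edges G \<subseteq> {1..t} \<and>
        (\<forall>e\<in>edges G. \<forall>i\<in>{1..t}.
           card {f \<in> edges G. f \<noteq> e \<and> \<phi> f = i \<and> crossing_points D e f \<noteq> {}} \<le> k))"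

end

theory Submission
  imports Defs
begin

text \<open>
  The planar skeleton consists of \<open>k = l + 2\<close> internally disjoint paths \<open>N, a\<^sub>i, b\<^sub>i, S\<close> between two
  poles; consecutive paths bound a hexagonal face, so there are \<open>2k + 2 = n\<close> vertices, \<open>3k\<close>
  skeleton edges and \<open>k\<close> faces. Into the face with corners \<open>N, a, b, S, b', a'\<close> go seven of its
  nine diagonals, all but \<open>N S\<close> and \<open>N b\<close>. The two omitted diagonals take part in seven of the
  fifteen crossings of a hexagon, so eight crossings per face remain, and a colouring of the
  seven diagonals with three colours exists in which no diagonal is crossed twice by the same
  colour. The totals are \<open>10k = 5 (n - 2)\<close> edges and \<open>8k = 4 (n - 2)\<close> crossings.

  All faces are drawn alike. Cutting the sphere along the path \<open>i = 0\<close> and spreading the poles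
  to horizontal lines turns it into the rectangle \<open>[0, 2k] \<times> [0, 3]\<close>, the union of \<open>k\<close> cells
  \<open>[2i, 2i + 2] \<times> [0, 3]\<close>, and in the cell coordinates every edge is a straight segment, taken from
  one list of ten. The map \<open>roll k\<close> from the strip to the plane wraps the rectangle up: it is
  periodic, collapses the bottom line to \<open>N\<close> and the top line to \<open>S\<close>, and has otherwise no
  coincidences. The inner points of the edges lie in the half-open cells, on whose union \<open>roll k\<close>
  is injective (\<open>roll_half_open_eqD\<close>), so that all questions about intersections in the plane
  become questions about ten segments in one cell. A transversal intersection of segments in the
  open cell is carried to a crossing in the topological sense by invariance of domain
  (\<open>crosses_at_image\<close>).

  The drawing is non-homotopic by a general criterion (\<open>non_homotopicI\<close>): no two edges meet twice in
  inner points, and of two parallel edges the first is crossed by some third edge that misses the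
  second. By Janiszewski's theorem the union of two arcs with connected intersection does not
  contain a closed curve, so lenses are bounded only by pairs of parallel edges, and their
  boundary is the whole of both edges. The third edge passes through that boundary exactly once;
  hence it enters the lens, cannot leave it again, and one of its end vertices lies inside. Here
  parallel edges lie in different faces and are diagonals, and each diagonal is crossed within
  its face.
\<close>

section \<open>Closed curves in the union of two arcs\<close>

lemma interior_arc_image_empty:
  fixes g :: "real \<Rightarrow> complex"
  assumes "arc g"
  shows "interior (path_image g) = {}"
proof (rule ccontr)
  assume ne: "interior (path_image g) \<noteq> {}"
  obtain h where h: "homeomorphism {0..1} (path_image g) g h"
    using homeomorphism_arc[OF assms] .
  have "continuous_on (path_image g) h" "inj_on h (path_image g)"
    using h by (auto simp: homeomorphism_def intro: inj_on_inverseI)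
  then have "DIM(complex) \<le> DIM(real)"
    using ne continuous_on_subset[OF _ interior_subset] inj_on_subset[OF _ interior_subset]
    by (intro invariance_of_dimension[of "interior (path_image g)" h]) blast+
  then show False by simp
qed

text \<open>The properties of a compact set that forbid it to contain a closed Jordan curve and that survive
  the union of two sets with connected intersection. The empty interior is included because a disc,
  say, has a connected complement and contains closed curves.\<close>

definition tree_like :: "complex set \<Rightarrow> bool" where
  "tree_like K \<longleftrightarrow> compact K \<and> interior K = {} \<and> connected (- K)"

lemma tree_like_arc: "arc g \<Longrightarrow> tree_like (path_image g)" for g :: "real \<Rightarrow> complex"
  by (simp add: tree_like_def compact_arc_image interior_arc_image_empty connected_arc_complement)

text \<open>Connectedness of the complement is Janiszewski's theorem.\<close>

lemma tree_like_Un: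
  assumes "tree_like S" "tree_like T" "connected (S \<inter> T)"
  shows "tree_like (S \<union> T)"
  using assms Janiszewski_connected[of S T] interior_closed_Un_empty_interior[of S T]
  by (auto simp: tree_like_def compact_imp_closed compact_Un)

text \<open>By the Jordan curve theorem the connected complement of \<open>K\<close> lies on one side of the curve, so the
  other side, a nonempty open set, is part of \<open>K\<close>.\<close>

lemma simple_closed_curve_not_in_tree_like:
  fixes c :: "real \<Rightarrow> complex"
  assumes "simple_path c" "pathfinish c = pathstart c" "tree_like K"
  shows "\<not> path_image c \<subseteq> K"
proof
  assume sub: "path_image c \<subseteq> K"
  obtain inner outer where io: "inner \<noteq> {}" "open inner" "outer \<noteq> {}" "open outer"
      "inner \<inter> outer = {}" "inner \<union> outer = - path_image c"
    using Jordan_curve[OF assms(1,2)] by metis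
  have "- K \<subseteq> inner \<union> outer" using sub io(6) by auto
  then have "inner \<inter> - K = {} \<or> outer \<inter> - K = {}"
    using assms(3) connectedD[of "- K" inner outer] io unfolding tree_like_def by auto
  then have "inner \<subseteq> K \<or> outer \<subseteq> K" by auto
  then show False
    using assms(3) io interior_maximal[of inner K] interior_maximal[of outer K]
    unfolding tree_like_def by auto
qed

text \<open>If the curve missed a point of \<open>a\<close>, a small subarc around this point could be cut out of \<open>a\<close>. Each of
  the two remaining pieces is attached to \<open>b\<close> at one end only, so that together with \<open>b\<close> they form a
  tree-like set, which cannot contain the curve.\<close>

lemma arcs_containing_closed_curve:
  fixes a b c :: "real \<Rightarrow> complex"
  assumes a: "arc a" and b: "arc b" and c: "simple_path c" "pathfinish c = pathstart c"
    and sub: "path_image c \<subseteq> path_image a \<union> path_image b"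
    and common: "path_image a \<inter> path_image b = {pathstart a, pathfinish a}"
  shows "path_image a \<subseteq> path_image c"
proof (rule ccontr)
  assume "\<not> path_image a \<subseteq> path_image c"
  then have ne: "- path_image c \<inter> path_image a \<noteq> {}" by auto
  have arc_a: "continuous_on {0..1} a" "inj_on a {0..1}"
    using a by (auto simp: arc_def path_def)
  \<comment> \<open>the curve is closed, so it misses a whole parameter interval of the first arc\<close>
  have op: "open (- path_image c)" using c by (simp add: open_Compl closed_simple_path_image)
  define T where "T = {0..1} \<inter> a -` (- path_image c)"
  have T: "openin (top_of_set {0..1}) T"
    unfolding T_def using continuous_openin_preimage_gen[OF arc_a(1) op] .
  obtain t0 where t0: "t0 \<in> T"
    using ne by (force simp: T_def path_image_def[of a])
  obtain d where d: "d > 0" "ball t0 d \<inter> {0..1} \<subseteq> T"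
    using T t0 by (auto simp: openin_contains_ball)
  obtain u v where uv: "0 < u" "u < v" "v < 1" "{u..v} \<subseteq> T"
  proof -
    define u where "u = max (t0 - d/2) 0"
    define v where "v = min (t0 + d/2) 1"
    have t01: "0 \<le> t0" "t0 \<le> 1" using t0 by (auto simp: T_def)
    have *: "u < v" "{u..v} \<subseteq> T" "0 \<le> u" "v \<le> 1"
      using d t01 by (auto simp: u_def v_def dist_real_def subset_iff)
    show thesis
      \<comment> \<open>shrinking to the middle third keeps the subarc away from both ends of the arc\<close>
      by (rule that[of "(2 * u + v) / 3" "(u + 2 * v) / 3"])
         (use * in \<open>auto intro!: subsetD[OF *(2)]\<close>)
  qed
  define A1 where "A1 = path_image (subpath 0 u a)"
  define A2 where "A2 = path_image (subpath v 1 a)"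
  have A: "A1 = a ` {0..u}" "A2 = a ` {v..1}"
    using uv by (auto simp: A1_def A2_def path_image_subpath)
  have tl: "tree_like A1" "tree_like A2" "tree_like (path_image b)"
    unfolding A1_def A2_def using uv a b by (auto intro!: tree_like_arc arc_subpath_arc)
  have ends: "path_image a \<inter> path_image b = {a 0, a 1}"
    using common by (simp add: pathstart_def pathfinish_def)
  have eq: "a s = a t \<longleftrightarrow> s = t" if "s \<in> {0..1}" "t \<in> {0..1}" for s t
    using arc_a(2) that by (auto dest: inj_onD)
  have pib: "a t \<in> path_image b \<longleftrightarrow> t = 0 \<or> t = 1" if t: "t \<in> {0..1}" for t
  proof -
    have "a t \<in> path_image b \<longleftrightarrow> a t \<in> {a 0, a 1}"
      using ends t unfolding path_image_def by blast
    then show ?thesis using eq t by auto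
  qed
  have "A1 \<inter> path_image b = {a 0}"
    unfolding A using pib uv by fastforce
  then have tl1: "tree_like (A1 \<union> path_image b)"
    using tl by (intro tree_like_Un) auto
  have "(A1 \<union> path_image b) \<inter> A2 = {a 1}"
    unfolding A using pib uv eq by fastforce
  then have "tree_like ((A1 \<union> path_image b) \<union> A2)"
    using tree_like_Un[OF tl1 tl(2)] by simp
  moreover have "path_image c \<subseteq> (A1 \<union> path_image b) \<union> A2"
  proof
    fix x assume x: "x \<in> path_image c"
    show "x \<in> (A1 \<union> path_image b) \<union> A2"
    proof (cases "x \<in> path_image b")
      case False
      then obtain t where t: "t \<in> {0..1}" "x = a t" using sub x unfolding path_image_def by auto
      have "t \<notin> T" using x t by (auto simp: T_def)
      then have "t < u \<or> v < t" using uv(4) by (meson atLeastAtMost_iff not_less subset_iff)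
      then show ?thesis using t unfolding A by auto
    qed auto
  qed
  ultimately show False
    using simple_closed_curve_not_in_tree_like[OF c] by blast
qed

section \<open>Edges that pass through the boundary of a region\<close>

text \<open>Near the crossing the boundary of the region coincides with \<open>A\<close>, which becomes the real axis in
  suitable coordinates. A point of the region close to the crossing therefore lies in an open half
  disc that avoids the boundary; the half disc is connected, hence contained in the region, and
  \<open>G\<close> runs through its middle.\<close>

lemma region_meets_transversal:
  assumes cr: "crosses_at A G p" and "closed B" "p \<notin> B"
    and R: "open R" "p \<in> frontier R" "frontier R \<subseteq> A \<union> B" "A \<subseteq> frontier R"
  obtains y where "y \<in> R" "y \<in> G" "y \<noteq> p"
proof -
  obtain U h h' where U: "open U" "p \<in> U" "homeomorphism U (ball 0 1) h h'" "h p = 0"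
        "h ` (A \<inter> U) = {z \<in> ball 0 1. Im z = 0}" "h ` (G \<inter> U) = {z \<in> ball 0 1. Re z = 0}"
    using cr unfolding crosses_at_def by blast
  have contU: "continuous_on U h" "continuous_on (ball 0 1) h'"
    and inv: "\<And>x. x \<in> U \<Longrightarrow> h' (h x) = x" "\<And>z. z \<in> ball 0 1 \<Longrightarrow> h (h' z) = z"
    and img: "h ` U = ball 0 1" "h' ` ball 0 1 = U"
    using U(3) by (auto simp: homeomorphism_def)
  have "open (ball 0 1 \<inter> h' -` (- B))"
    using contU(2) \<open>closed B\<close> by (intro continuous_open_preimage) auto
  moreover have "0 \<in> ball 0 1 \<inter> h' -` (- B)"
    using inv(1)[OF U(2)] U(4) \<open>p \<notin> B\<close> by auto
  ultimately obtain r where r: "r > 0" "ball 0 r \<subseteq> ball 0 1 \<inter> h' -` (- B)"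
    by (meson openE)
  then have rB: "\<And>z. z \<in> ball 0 r \<Longrightarrow> z \<in> ball 0 1 \<and> h' z \<notin> B" by auto
  define W where "W = U \<inter> h -` ball 0 r"
  have W: "open W" "p \<in> W"
    using contU(1) U(1,2,4) r(1) by (auto simp: W_def intro: continuous_open_preimage)
  have "p \<in> closure R" using R(2) by (simp add: frontier_def)
  then obtain x where x: "x \<in> R" "x \<in> W"
    using W open_Int_closure_eq_empty[of W R] by blast
  have "x \<notin> A" using x(1) R(1,4) by (auto simp: frontier_def interior_open)
  define S where "S = {z. 0 < Im z * Im (h x)} \<inter> ball 0 r"
  have offA: "h' z \<notin> A" if "z \<in> ball 0 1" "Im z \<noteq> 0" for z
  proof
    assume "h' z \<in> A"
    then have "h (h' z) \<in> h ` (A \<inter> U)" using img that by auto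
    then show False using inv that U(5) by auto
  qed
  have Imx: "Im (h x) \<noteq> 0"
  proof
    assume "Im (h x) = 0"
    moreover have "h x \<in> ball 0 1" using x(2) rB by (auto simp: W_def)
    ultimately have "h x \<in> h ` (A \<inter> U)" using U(5) by auto
    then obtain q where "q \<in> A" "q \<in> U" "h x = h q" by auto
    then show False using \<open>x \<notin> A\<close> x(2) inv by (metis IntD1 W_def)
  qed
  have "convex S"
  proof -
    have "S = (if Im (h x) > 0 then {z. 0 < Im z} else {z. Im z < 0}) \<inter> ball 0 r"
      using Imx by (auto simp: S_def zero_less_mult_iff)
    then show ?thesis
      by (auto intro!: convex_Int convex_halfspace_Im_gt convex_halfspace_Im_lt)
  qed
  then have conn: "connected (h' ` S)"
    using contU(2) rB by (intro connected_continuous_image convex_connected)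
      (auto simp: S_def intro: continuous_on_subset)
  have "h' ` S \<inter> frontier R = {}"
  proof -
    have "h' z \<notin> A \<union> B" if "z \<in> S" for z
    proof -
      have "Im z \<noteq> 0" using that by (auto simp: S_def)
      then show ?thesis using that rB[of z] offA[of z] by (auto simp: S_def)
    qed
    then show ?thesis using R(3) by auto
  qed
  moreover have "x \<in> h' ` S"
  proof
    show "x = h' (h x)" using x(2) inv by (simp add: W_def)
    show "h x \<in> S" using x(2) Imx by (auto simp: S_def W_def zero_less_mult_iff)
  qed
  ultimately have sub: "h' ` S \<subseteq> R"
    using connected_Int_frontier[OF conn, of R] x(1) by blast
  define z where "z = Complex 0 (sgn (Im (h x)) * r / 2)"
  have zn: "norm z = r / 2"
    using Imx r(1) by (simp add: z_def cmod_def sgn_if power_divide real_sqrt_divide)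
  have "z \<in> S"
    using Imx r(1) zn by (auto simp: S_def z_def sgn_if mult_less_0_iff zero_less_mult_iff)
  then have zb: "z \<in> ball 0 1" using rB by (auto simp: S_def)
  show thesis
  proof
    show "h' z \<in> R" using sub \<open>z \<in> S\<close> by auto
    have "z \<in> h ` (G \<inter> U)" using U(6) zb by (auto simp: z_def)
    then show "h' z \<in> G" using inv by auto
    show "h' z \<noteq> p"
    proof
      assume "h' z = p"
      then have "z = 0" using inv(2)[OF zb] U(4) by simp
      then show False using zn r(1) by simp
    qed
  qed
qed

text \<open>An arc that meets the boundary in at most one point can leave the region in at most one of the two
  directions.\<close>

lemma arc_end_in_region:
  fixes g :: "real \<Rightarrow> complex"
  assumes g: "arc g" and p: "path_image g \<inter> frontier R \<subseteq> {p}"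
    and y: "y \<in> path_image g" "y \<in> R" "y \<noteq> p"
  shows "pathstart g \<in> R \<or> pathfinish g \<in> R"
proof -
  obtain s where s: "s \<in> {0..1}" "y = g s" using y(1) by (auto simp: path_image_def)
  have cg: "continuous_on {0..1} g" "inj_on g {0..1}" using g by (auto simp: arc_def path_def)
  have key: "g ` I \<subseteq> R" if I: "connected I" "I \<subseteq> {0..1}" "s \<in> I" "p \<notin> g ` I" for I
  proof -
    have "connected (g ` I)"
      using I cg by (intro connected_continuous_image) (auto intro: continuous_on_subset)
    moreover have "g ` I \<inter> frontier R = {}"
      using p I by (auto simp: path_image_def)
    moreover have "g ` I \<inter> R \<noteq> {}" using I s y(2) by auto
    ultimately show ?thesis using connected_Int_frontier[of "g ` I" R] by blast
  qed
  show ?thesis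
  proof (cases "p \<in> g ` {0..s}")
    case False
    then have "g 0 \<in> R" using key[of "{0..s}"] s(1) by auto
    then show ?thesis by (simp add: pathstart_def)
  next
    case True
    then obtain t where t: "t \<in> {0..s}" "p = g t" by auto
    have "t \<noteq> s" using t s y(3) by auto
    have "p \<notin> g ` {s..1}"
    proof
      assume "p \<in> g ` {s..1}"
      then obtain t' where "t' \<in> {s..1}" "g t = g t'" using t by auto
      then show False using cg(2) t s \<open>t \<noteq> s\<close> by (auto dest!: inj_onD)
    qed
    then have "g 1 \<in> R" using key[of "{s..1}"] s(1) by auto
    then show ?thesis by (simp add: pathfinish_def)
  qed
qed

section \<open>A criterion for non-homotopic drawings\<close>

lemma is_drawing_edgeD:
  assumes "is_drawing G D" "e \<in> edges G"
  shows "arc (curve D e)"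
    and "{pathstart (curve D e), pathfinish (curve D e)} = point D ` ends G e"
    and "edge_inner D e \<inter> point D ` verts G = {}"
  using assms by (auto simp: is_drawing_def)

lemma is_drawing_pairD:
  assumes "is_drawing G D" "e \<in> edges G" "f \<in> edges G" "e \<noteq> f"
  shows "edge_inner D e \<inter> edge_inner D f \<subseteq> crossing_points D e f"
    and "ends G e \<inter> ends G f \<noteq> {} \<Longrightarrow> edge_inner D e \<inter> edge_inner D f = {}"
  using assms unfolding is_drawing_def by metis+

lemma edge_image_eq:
  assumes "is_drawing G D" "e \<in> edges G"
  shows "edge_image D e = edge_inner D e \<union> point D ` ends G e"
proof -
  have "{pathstart (curve D e), pathfinish (curve D e)} \<subseteq> edge_image D e"
    using pathstart_in_path_image[of "curve D e"] pathfinish_in_path_image[of "curve D e"] by blast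
  then show ?thesis
    unfolding edge_inner_def is_drawing_edgeD(2)[OF assms, symmetric] by blast
qed

lemma edge_images_Int:
  assumes G: "wf_multigraph G" and D: "is_drawing G D"
    and ef: "e \<in> edges G" "f \<in> edges G"
  shows "edge_image D e \<inter> edge_image D f =
    (edge_inner D e \<inter> edge_inner D f) \<union> point D ` (ends G e \<inter> ends G f)"
proof -
  have sub: "ends G e \<subseteq> verts G" "ends G f \<subseteq> verts G"
    using G ef by (auto simp: wf_multigraph_def)
  have "edge_inner D e \<inter> point D ` ends G f = {}" "edge_inner D f \<inter> point D ` ends G e = {}"
    using is_drawing_edgeD(3)[OF D] ef sub by blast+
  moreover have "point D ` (ends G e \<inter> ends G f) = point D ` ends G e \<inter> point D ` ends G f"
    using D sub unfolding is_drawing_def by (intro inj_on_image_Int[of _ "verts G"]) auto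
  ultimately show ?thesis
    unfolding edge_image_eq[OF D ef(1)] edge_image_eq[OF D ef(2)] by blast
qed

text \<open>The boundary of a lens is a closed curve in the union of two edges, whose intersection is then
  disconnected and hence has two points. Since nonadjacent edges meet at most once and adjacent ones
  only in common end vertices, the two edges are parallel, and the lens is bounded by all of both.
  The edge \<open>g\<close> meets this boundary only where it crosses \<open>e\<close>; as it is not adjacent to \<open>e\<close>, its end
  inside the lens is not on the boundary.\<close>

lemma non_homotopicI:
  assumes G: "wf_multigraph G" and D: "is_drawing G D"
    and once: "\<And>e f x y. \<lbrakk>e \<in> edges G; f \<in> edges G; e \<noteq> f;
      x \<in> edge_inner D e \<inter> edge_inner D f; y \<in> edge_inner D e \<inter> edge_inner D f\<rbrakk> \<Longrightarrow> x = y"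
    and par: "\<And>e f. \<lbrakk>e \<in> edges G; f \<in> edges G; e \<noteq> f; ends G e = ends G f\<rbrakk> \<Longrightarrow>
      \<exists>g\<in>edges G. g \<noteq> e \<and> edge_inner D e \<inter> edge_inner D g \<noteq> {} \<and>
        edge_inner D f \<inter> edge_inner D g = {}"
  shows "non_homotopic G D"
  unfolding non_homotopic_def
proof (intro ballI allI impI)
  fix e f R
  assume e: "e \<in> edges G" and f: "f \<in> edges G" and "e \<noteq> f \<and> lens_region D e f R"
  then have ef: "e \<noteq> f" and R: "open R" "frontier R \<subseteq> edge_image D e \<union> edge_image D f"
    by (auto simp: lens_region_def)
  obtain c where c: "simple_path c" "pathfinish c = pathstart c" "path_image c = frontier R"
    using \<open>e \<noteq> f \<and> lens_region D e f R\<close> by (auto simp: lens_region_def)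
  have arc: "arc (curve D e)" "arc (curve D f)" using is_drawing_edgeD(1)[OF D] e f by blast+
  have "\<not> connected (edge_image D e \<inter> edge_image D f)"
  proof
    assume "connected (edge_image D e \<inter> edge_image D f)"
    then have "tree_like (edge_image D e \<union> edge_image D f)"
      using arc by (intro tree_like_Un tree_like_arc)
    then show False using simple_closed_curve_not_in_tree_like[OF c(1,2)] c(3) R(2) by metis
  qed
  then have two: "\<nexists>x. edge_image D e \<inter> edge_image D f \<subseteq> {x}"
    by (metis connected_empty connected_sing subset_singletonD)
  have adj: "ends G e \<inter> ends G f \<noteq> {}"
  proof
    assume disj: "ends G e \<inter> ends G f = {}"
    then have "edge_image D e \<inter> edge_image D f = edge_inner D e \<inter> edge_inner D f"
      using edge_images_Int[OF G D e f] by simp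
    then show False using two once[OF e f ef] by blast
  qed
  then have inner: "edge_inner D e \<inter> edge_inner D f = {}"
    using is_drawing_pairD(2)[OF D e f ef adj] by blast
  have cards: "card (ends G e) = 2" "card (ends G f) = 2"
    using G e f by (auto simp: wf_multigraph_def)
  have same: "ends G e = ends G f"
  proof (rule ccontr)
    assume "ends G e \<noteq> ends G f"
    then obtain v where "ends G e \<inter> ends G f \<subseteq> {v}"
      using cards unfolding card_2_iff by (smt (verit) Int_iff insertE singletonD insert_commute subsetI singletonI)
    then have "edge_image D e \<inter> edge_image D f \<subseteq> {point D v}"
      using edge_images_Int[OF G D e f] inner by blast
    then show False using two by blast
  qed
  have common: "edge_image D e \<inter> edge_image D f = point D ` ends G e"
    using edge_images_Int[OF G D e f] inner same by simp
  also have ends_e: "\<dots> = {pathstart (curve D e), pathfinish (curve D e)}"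
    using is_drawing_edgeD(2)[OF D e] by simp
  finally have eR: "edge_image D e \<subseteq> frontier R"
    using arcs_containing_closed_curve[OF arc c(1,2)] R(2) c(3) by simp
  obtain g where g: "g \<in> edges G" "g \<noteq> e" "edge_inner D e \<inter> edge_inner D g \<noteq> {}"
      "edge_inner D f \<inter> edge_inner D g = {}"
    using par[OF e f ef same] by blast
  then obtain p where p: "p \<in> edge_inner D e" "p \<in> edge_inner D g" by blast
  have nadj: "ends G e \<inter> ends G g = {}"
    using is_drawing_pairD(2)[OF D e g(1)] g(2,3) by blast
  have pe: "edge_image D e \<inter> edge_image D g \<subseteq> {p}"
    using edge_images_Int[OF G D e g(1)] nadj once[OF e g(1)] g(2) p by auto
  have fg: "edge_image D f \<inter> edge_image D g = {}"
    using edge_images_Int[OF G D f g(1)] nadj same g(4) by auto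
  have cross: "crosses_at (edge_image D e) (edge_image D g) p"
    using is_drawing_pairD(1)[OF D e g(1)] g(2) p by (auto simp: crossing_points_def)
  have pin: "p \<in> edge_image D e" "p \<in> edge_image D g"
    using p by (auto simp: edge_inner_def)
  obtain y where y: "y \<in> R" "y \<in> edge_image D g" "y \<noteq> p"
    using region_meets_transversal[OF cross closed_arc_image[OF arc(2)] _ R(1) _ R(2) eR] pin fg eR
    by blast
  have "arc (curve D g)" using is_drawing_edgeD(1)[OF D g(1)] .
  moreover have "edge_image D g \<inter> frontier R \<subseteq> {p}"
    using R(2) pe fg by blast
  ultimately have "pathstart (curve D g) \<in> R \<or> pathfinish (curve D g) \<in> R"
    using arc_end_in_region y by blast
  moreover have "{pathstart (curve D g), pathfinish (curve D g)} \<subseteq> point D ` verts G"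
    using is_drawing_edgeD(2)[OF D g(1)] G g(1) unfolding wf_multigraph_def by auto
  ultimately show "R \<inter> (point D ` verts G \<union> crossings G D) \<noteq> {}" by blast
qed

section \<open>Images of crossing segments\<close>

lemma path_image_minus_ends:
  assumes "arc g"
  shows "path_image g - {pathstart g, pathfinish g} = g ` {0<..<1}"
proof -
  have "{0<..<1} = {0..1} - {0, 1::real}" by (auto simp: less_le)
  moreover have "g ` ({0..1} - {0, 1}) = g ` {0..1} - g ` {0, 1}"
    using assms by (intro inj_on_image_set_diff[of g "{0..1}"]) (auto simp: arc_def)
  ultimately show ?thesis by (simp add: path_image_def pathstart_def pathfinish_def)
qed

text \<open>In the affine coordinates with origin \<open>c\<close> and axis directions \<open>d\<close> and \<open>d'\<close>, scaled so that the unit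
  disc lies in \<open>V\<close> and its axes within the two segments, the segments are the coordinate axes. Composed
  with \<open>f\<close> they parametrize a neighbourhood of \<open>f c\<close>, and by invariance of domain the inverse of this
  parametrization is a chart as required.\<close>

lemma crosses_at_image:
  fixes f :: "complex \<Rightarrow> complex"
  assumes V: "open V" "continuous_on V f" "inj_on f V" "c \<in> V"
    and c: "c = p + of_real s * d" "c = p' + of_real s' * d'" "0 < s" "s < 1" "0 < s'" "s' < 1"
    and det: "Re d * Im d' \<noteq> Im d * Re d'"
    and A: "A \<inter> f ` V = f ` (V \<inter> (\<lambda>u. p + of_real u * d) ` {0..1})"
    and B: "B \<inter> f ` V = f ` (V \<inter> (\<lambda>u. p' + of_real u * d') ` {0..1})"
  shows "crosses_at A B (f c)"
proof -
  obtain \<delta> where \<delta>: "\<delta> > 0" "ball c \<delta> \<subseteq> V" using openE[OF V(1,4)] by blast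
  define M where "M = norm d + norm d' + 1"
  have M: "M > 0" unfolding M_def by (intro add_nonneg_pos add_nonneg_nonneg norm_ge_zero zero_less_one)
  define \<epsilon> where "\<epsilon> = Min {s, 1 - s, s', 1 - s', \<delta> / M}"
  have \<epsilon>: "\<epsilon> > 0" "\<epsilon> \<le> s" "\<epsilon> \<le> 1 - s" "\<epsilon> \<le> s'" "\<epsilon> \<le> 1 - s'" "\<epsilon> \<le> \<delta> / M"
    using c(3-) \<delta> M by (auto simp: \<epsilon>_def)
  define L where "L z = c + of_real \<epsilon> * (of_real (Re z) * d + of_real (Im z) * d')" for z
  have indep: "x = 0 \<and> y = 0" if "of_real x * d + of_real y * d' = 0" for x y :: real
  proof -
    have "x * Re d + y * Re d' = 0" "x * Im d + y * Im d' = 0"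
      using that by (simp_all add: complex_eq_iff)
    then have "x * (Re d * Im d' - Im d * Re d') = 0" "y * (Re d * Im d' - Im d * Re d') = 0"
      by algebra+
    then show ?thesis using det by simp
  qed
  have injL: "inj L"
  proof (rule injI)
    fix z w assume "L z = L w"
    then have "of_real (Re z) * d + of_real (Im z) * d' = of_real (Re w) * d + of_real (Im w) * d'"
      using \<epsilon>(1) by (simp add: L_def)
    then have "of_real (Re z - Re w) * d + of_real (Im z - Im w) * d' = 0"
      unfolding of_real_diff by algebra
    then have "Re z - Re w = 0 \<and> Im z - Im w = 0" by (rule indep)
    then show "z = w" by (simp add: complex_eq_iff)
  qed
  have LV: "L z \<in> V" if z: "z \<in> ball 0 1" for z
  proof -
    have "norm (of_real (Re z) * d + of_real (Im z) * d') \<le> \<bar>Re z\<bar> * norm d + \<bar>Im z\<bar> * norm d'"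
      by (rule order_trans[OF norm_triangle_ineq]) (simp add: norm_mult)
    also have "\<dots> \<le> 1 * norm d + 1 * norm d'"
      using z abs_Re_le_cmod[of z] abs_Im_le_cmod[of z] by (intro add_mono mult_right_mono) auto
    also have "\<dots> < M" by (simp add: M_def)
    finally have "\<epsilon> * norm (of_real (Re z) * d + of_real (Im z) * d') < \<epsilon> * M"
      using \<epsilon>(1) by simp
    also have "\<dots> \<le> \<delta>" using \<epsilon>(6) M by (simp add: field_simps)
    finally have "L z \<in> ball c \<delta>"
      using \<epsilon>(1) by (simp add: L_def dist_norm norm_mult)
    then show ?thesis using \<delta> by auto
  qed
  define g where "g = f \<circ> L"
  have g_inj: "inj_on g (ball 0 1)"
    unfolding g_def using injL LV V(3)
    by (intro comp_inj_on) (auto intro: inj_on_subset simp: image_subset_iff)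
  have "continuous_on (ball 0 1) L" unfolding L_def by (intro continuous_intros)
  then have g_cont: "continuous_on (ball 0 1) g"
    unfolding g_def using LV V(2)
    by (intro continuous_on_compose) (auto intro: continuous_on_subset simp: image_subset_iff)
  obtain h where h: "homeomorphism (ball 0 1) (g ` ball 0 1) g h"
    using invariance_of_domain_homeomorphism[OF _ g_cont _ g_inj] by auto
  define U where "U = g ` ball 0 1"
  have "open U" unfolding U_def using invariance_of_domain[OF g_cont _ g_inj] by simp
  have hg: "h (g z) = z" if "z \<in> ball 0 1" for z
    using h that by (simp add: homeomorphism_apply1)
  have "g 0 = f c" by (simp add: g_def L_def)
  then have fc: "f c \<in> U" "h (f c) = 0"
    using hg[of 0] imageI[of 0 "ball 0 1" g] unfolding U_def by simp_all
  have UV: "U \<subseteq> f ` V" using LV by (auto simp: U_def g_def)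
  have axis: "h ` (X \<inter> U) = {z \<in> ball 0 1. P z}"
    if X: "X \<inter> f ` V = f ` (V \<inter> S)" and S: "\<And>z. z \<in> ball 0 1 \<Longrightarrow> L z \<in> S \<longleftrightarrow> P z" for X S P
  proof -
    have "g z \<in> X \<longleftrightarrow> P z" if z: "z \<in> ball 0 1" for z
    proof -
      have "g z \<in> X \<longleftrightarrow> f (L z) \<in> f ` (V \<inter> S)"
        using X LV[OF z] by (auto simp: g_def)
      also have "\<dots> \<longleftrightarrow> L z \<in> S" using V(3) LV[OF z] by (auto dest: inj_onD)
      finally show ?thesis using S z by simp
    qed
    then have "X \<inter> U = g ` {z \<in> ball 0 1. P z}" unfolding U_def by auto
    also have "h ` \<dots> = {z \<in> ball 0 1. P z}"
      unfolding image_image using hg by (force simp: image_iff)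
    finally show ?thesis .
  qed
  have "L z \<in> (\<lambda>u. p + of_real u * d) ` {0..1} \<longleftrightarrow> Im z = 0" if z: "z \<in> ball 0 1" for z
  proof
    assume "L z \<in> (\<lambda>u. p + of_real u * d) ` {0..1}"
    then obtain u where "L z = p + of_real u * d" by auto
    then have "of_real (s + \<epsilon> * Re z - u) * d + of_real (\<epsilon> * Im z) * d' = 0"
      unfolding L_def c(1) of_real_add of_real_diff of_real_mult by algebra
    then have "\<epsilon> * Im z = 0" using indep by blast
    then show "Im z = 0" using \<epsilon>(1) by simp
  next
    assume 0: "Im z = 0"
    have "\<bar>\<epsilon> * Re z\<bar> \<le> \<epsilon> * 1"
      using z abs_Re_le_cmod[of z] \<epsilon>(1) by (simp add: abs_mult)
    then have "s + \<epsilon> * Re z \<in> {0..1}" using \<epsilon> by auto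
    moreover have "L z = p + of_real (s + \<epsilon> * Re z) * d"
      unfolding L_def c(1) 0 of_real_add of_real_mult of_real_0 by algebra
    ultimately show "L z \<in> (\<lambda>u. p + of_real u * d) ` {0..1}" by blast
  qed
  note on_A = axis[OF A this]
  have "L z \<in> (\<lambda>u. p' + of_real u * d') ` {0..1} \<longleftrightarrow> Re z = 0" if z: "z \<in> ball 0 1" for z
  proof
    assume "L z \<in> (\<lambda>u. p' + of_real u * d') ` {0..1}"
    then obtain u where "L z = p' + of_real u * d'" by auto
    then have "of_real (\<epsilon> * Re z) * d + of_real (s' + \<epsilon> * Im z - u) * d' = 0"
      unfolding L_def c(2) of_real_add of_real_diff of_real_mult by algebra
    then have "\<epsilon> * Re z = 0" using indep by blast
    then show "Re z = 0" using \<epsilon>(1) by simp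
  next
    assume 0: "Re z = 0"
    have "\<bar>\<epsilon> * Im z\<bar> \<le> \<epsilon> * 1"
      using z abs_Im_le_cmod[of z] \<epsilon>(1) by (simp add: abs_mult)
    then have "s' + \<epsilon> * Im z \<in> {0..1}" using \<epsilon> by auto
    moreover have "L z = p' + of_real (s' + \<epsilon> * Im z) * d'"
      unfolding L_def c(2) 0 of_real_add of_real_mult of_real_0 by algebra
    ultimately show "L z \<in> (\<lambda>u. p' + of_real u * d') ` {0..1}" by blast
  qed
  note on_B = axis[OF B this]
  show ?thesis
    unfolding crosses_at_def
    using \<open>open U\<close> fc homeomorphism_sym[THEN iffD1, OF h] on_A on_B unfolding U_def by blast
qed

section \<open>Wrapping the strip around the poles\<close>

text \<open>Polar coordinates, with the angle normalized so that it turns once as the real part grows by \<open>2k\<close>.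
  The shift by \<open>1/2\<close> puts the point that \<open>roll\<close> sends to infinity off all edges.\<close>

definition spin :: "nat \<Rightarrow> complex \<Rightarrow> complex" where
  "spin k w = of_real (Im w) * cis (pi * (Re w - 1/2) / real k)"

text \<open>The value at \<open>w = x + \<i> y\<close> is the image of the point with polar coordinates \<open>r = y / (3 - y)\<close> and
  \<open>\<theta> = \<pi> (x - 1/2) / k\<close> under the Moebius transformation \<open>u / (u - 1)\<close>, which moves \<open>\<infinity>\<close>, the
  place of \<open>S\<close>, to the finite point \<open>1\<close>. Clearing the denominator \<open>3 - y\<close> makes the formula valid on the line
  \<open>y = 3\<close> as well.\<close>

definition roll :: "nat \<Rightarrow> complex \<Rightarrow> complex" where
  "roll k w = spin k w / (spin k w + of_real (Im w - 3))"

text \<open>The points sent to infinity are excluded; they have \<open>y = 3/2\<close> and \<open>\<theta> \<in> 2 \<pi> \<int>\<close>.\<close>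

definition strip :: "nat \<Rightarrow> complex set" where
  "strip k = {w. 0 \<le> Im w \<and> Im w \<le> 3 \<and> spin k w \<noteq> of_real (3 - Im w)}"

lemma roll_denominator:
  assumes "w \<in> strip k"
  shows "spin k w + of_real (Im w - 3) \<noteq> 0"
proof
  assume "spin k w + of_real (Im w - 3) = 0"
  then have "spin k w = - of_real (Im w - 3)" by (rule eq_neg_iff_add_eq_0[THEN iffD2])
  then have "spin k w = of_real (3 - Im w)" by simp
  then show False using assms by (simp add: strip_def)
qed

lemma continuous_on_roll:
  assumes "0 < k"
  shows "continuous_on (strip k) (roll k)"
proof -
  have "continuous_on (strip k) (spin k)"
    unfolding spin_def using assms by (intro continuous_intros) auto
  then show ?thesis
    unfolding roll_def by (intro continuous_intros ballI roll_denominator)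
qed

lemma roll_bottom: "Im w = 0 \<Longrightarrow> roll k w = 0"
  by (simp add: roll_def spin_def)

lemma roll_top: "Im w = 3 \<Longrightarrow> roll k w = 1"
  by (simp add: roll_def spin_def)

lemma norm_spin: "0 \<le> Im w \<Longrightarrow> norm (spin k w) = Im w"
  by (simp add: spin_def norm_mult)

lemma cis_eq_imp: "cis a = cis b \<Longrightarrow> \<exists>m::int. a - b = 2 * pi * of_int m"
proof -
  assume "cis a = cis b"
  then have "cis (a - b) = 1" by (simp add: cis_divide[symmetric])
  then have "cos (a - b) = 1" by (metis cis.sel(1) one_complex.sel(1))
  then show ?thesis by (auto simp: cos_one_2pi_int algebra_simps)
qed

lemma even_integer_small:
  fixes x :: real and z :: int
  assumes "x = 2 * of_int z" "x < 2" "- 2 < x"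
  shows "z = 0"
proof -
  have "of_int z < (1::real)" "(- 1::real) < of_int z" using assms by simp_all
  then show ?thesis by linarith
qed

text \<open>Cross-multiplication gives \<open>spin k w * (Im v - 3) = spin k v * (Im w - 3)\<close>. Norms
  determine the height, and away from the two extreme heights the remaining factors determine the angle.\<close>

lemma roll_eqD:
  assumes k: "0 < k" and w: "w \<in> strip k" "v \<in> strip k" and eq: "roll k w = roll k v"
  shows "Im w = Im v \<and> (Im w = 0 \<or> Im w = 3 \<or> (\<exists>m::int. Re w - Re v = 2 * real k * of_int m))"
proof -
  note den = roll_denominator[OF w(1)] roll_denominator[OF w(2)]
  have Im: "0 \<le> Im w" "Im w \<le> 3" "0 \<le> Im v" "Im v \<le> 3" using w by (auto simp: strip_def)
  have cross: "spin k w * of_real (Im v - 3) = spin k v * of_real (Im w - 3)"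
  proof -
    have "spin k w * (spin k v + of_real (Im v - 3)) = spin k v * (spin k w + of_real (Im w - 3))"
      using frac_eq_eq[THEN iffD1, OF den eq[unfolded roll_def]] .
    then show ?thesis by (simp only: ring_distribs mult.commute[of "spin k w" "spin k v"] add_left_cancel)
  qed
  then have "norm (spin k w * of_real (Im v - 3)) = norm (spin k v * of_real (Im w - 3))"
    by (rule arg_cong)
  then have "Im w * (3 - Im v) = Im v * (3 - Im w)"
    using Im by (simp only: norm_mult norm_spin norm_of_real) simp
  then have same: "Im w = Im v" by (simp add: algebra_simps)
  moreover have "\<exists>m::int. Re w - Re v = 2 * real k * of_int m" if "Im w \<noteq> 0" "Im w \<noteq> 3"
  proof -
    have "cis (pi * (Re w - 1/2) / real k) = cis (pi * (Re v - 1/2) / real k)"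
    proof -
      have "complex_of_real (Im v - 3) \<noteq> 0" "complex_of_real (Im v) \<noteq> 0"
        using that same by (simp_all only: of_real_eq_0_iff) simp_all
      then show ?thesis using cross same by (simp add: spin_def del: of_real_diff)
    qed
    then obtain m :: int where "pi * (Re w - 1/2) / real k - pi * (Re v - 1/2) / real k = 2 * pi * m"
      using cis_eq_imp by blast
    then have "pi * (Re w - Re v) = pi * (2 * real k * m)"
      using k by (simp add: field_simps)
    then show ?thesis using mult_left_cancel[OF pi_neq_zero] by blast
  qed
  ultimately show ?thesis by blast
qed

text \<open>Cells have width \<open>2\<close>, so that the ends of all edges have integer coordinates.\<close>

definition cell_point :: "nat \<Rightarrow> complex \<Rightarrow> complex" where
  "cell_point i w = w + 2 * of_nat i"

lemma cell_point_sel [simp]: "Re (cell_point i w) = Re w + 2 * real i" "Im (cell_point i w) = Im w"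
  by (simp_all add: cell_point_def)

text \<open>The point \<open>(1/2, 3/2)\<close> is removed because \<open>roll\<close> sends it to infinity in the cell \<open>0\<close>.
  No edge of any cell runs through it.\<close>

definition cell :: "complex set" where
  "cell = {w. 0 \<le> Re w \<and> Re w \<le> 2 \<and> 0 \<le> Im w \<and> Im w \<le> 3} - {Complex (1/2) (3/2)}"

lemma cell_point_in_strip:
  assumes k: "0 < k" and w: "w \<in> cell"
  shows "cell_point i w \<in> strip k"
proof (rule ccontr)
  assume "cell_point i w \<notin> strip k"
  then have eq: "spin k (cell_point i w) = of_real (3 - Im w)"
    using w by (auto simp: strip_def cell_def)
  then have "norm (spin k (cell_point i w)) = norm (complex_of_real (3 - Im w))"
    by (rule arg_cong)
  then have "Im w = 3 - Im w"
    using w norm_spin[of "cell_point i w" k] by (simp only: norm_of_real) (simp add: cell_def)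
  then have Imw: "Im w = 3/2" by simp
  have "of_real (3/2) * cis (pi * (Re w + 2 * real i - 1/2) / real k) = of_real (3/2) * cis 0"
    using eq unfolding spin_def cell_point_sel Imw by simp
  then have "cis (pi * (Re w + 2 * real i - 1/2) / real k) = cis 0"
    by (simp only: mult_cancel_left) simp
  then obtain m :: int where "pi * (Re w + 2 * real i - 1/2) / real k - 0 = 2 * pi * m"
    using cis_eq_imp by blast
  then have "pi * (Re w - 1/2) = pi * (2 * (real k * m - real i))"
    using k by (simp add: field_simps)
  then have "Re w - 1/2 = 2 * (real k * m - real i)"
    using mult_left_cancel[OF pi_neq_zero] by blast
  then have "Re w - 1/2 = 2 * of_int (int k * m - int i)" by simp
  moreover have "0 \<le> Re w" "Re w \<le> 2" using w by (auto simp: cell_def)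
  ultimately have "int k * m - int i = 0"
    by (intro even_integer_small[of "Re w - 1/2"]) linarith+
  with \<open>Re w - 1/2 = 2 * of_int (int k * m - int i)\<close> have "w = Complex (1/2) (3/2)"
    using Imw by (simp add: complex_eq_iff)
  then show False using w by (simp add: cell_def)
qed

definition half_open_cell :: "complex set" where
  "half_open_cell = {w \<in> cell. Re w < 2 \<and> 0 < Im w \<and> Im w < 3}"

text \<open>The real parts of points in the first \<open>k\<close> half-open cells differ by less than the period \<open>2k\<close>.\<close>

lemma roll_half_open_eqD:
  assumes "i < k" "j < k" "w \<in> half_open_cell" "v \<in> half_open_cell"
    and "roll k (cell_point i w) = roll k (cell_point j v)"
  shows "i = j \<and> w = v"
proof -
  have "w \<in> cell" "v \<in> cell" using assms by (auto simp: half_open_cell_def)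
  with assms roll_eqD[of k "cell_point i w" "cell_point j v"]
  obtain m :: int where m: "Im w = Im v" "Re w + 2 * real i - (Re v + 2 * real j) = 2 * real k * m"
    by (auto simp: cell_point_in_strip half_open_cell_def)
  have b: "0 \<le> Re w" "Re w < 2" "0 \<le> Re v" "Re v < 2"
    using assms by (auto simp: half_open_cell_def cell_def)
  have "real i + 1 \<le> k" "real j + 1 \<le> k" using assms by linarith+
  then have lt: "\<bar>2 * real k * m\<bar> < 2 * real k" using b m(2) by linarith
  have "m = 0"
  proof (rule ccontr)
    assume "m \<noteq> 0"
    then have "1 \<le> \<bar>real_of_int m\<bar>" by linarith
    then have "2 * real k * 1 \<le> 2 * real k * \<bar>real_of_int m\<bar>" by (intro mult_left_mono) auto
    then show False using lt by (simp add: abs_mult)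
  qed
  then have d: "Re w - Re v = 2 * (real j - real i)" using m by simp
  then have "Re w - Re v = 2 * of_int (int j - int i)" by simp
  then have "int j - int i = 0"
    using b by (intro even_integer_small[of "Re w - Re v"]) linarith+
  then have "i = j" by simp
  then show ?thesis using d m by (simp add: complex_eq_iff)
qed

lemma roll_avoids_poles:
  assumes "0 < k" "w \<in> half_open_cell" shows "roll k (cell_point i w) \<notin> {0, 1}"
proof -
  have w: "w \<in> cell" "0 < Im w" "Im w < 3" using assms by (auto simp: half_open_cell_def)
  have zero: "Complex 0 0 \<in> cell" "Complex 0 3 \<in> cell" by (auto simp: cell_def)
  note st = cell_point_in_strip[OF assms(1)]
  have "roll k (cell_point 0 (Complex 0 0)) = 0" "roll k (cell_point 0 (Complex 0 3)) = 1"
    by (simp_all add: roll_bottom roll_top)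
  then show ?thesis
    using roll_eqD[OF assms(1) st[OF w(1)] st[OF zero(1)], of i 0]
      roll_eqD[OF assms(1) st[OF w(1)] st[OF zero(2)], of i 0] w
    by auto
qed

definition open_cell :: "complex set" where
  "open_cell = {w \<in> half_open_cell. 0 < Re w}"

lemma open_open_cell: "open open_cell"
proof -
  have "open_cell = {w. 0 < Re w} \<inter> {w. Re w < 2} \<inter> {w. 0 < Im w} \<inter> {w. Im w < 3} - {Complex (1/2) (3/2)}"
    by (auto simp: open_cell_def half_open_cell_def cell_def)
  moreover have "open ({w. 0 < Re w} \<inter> {w. Re w < 2} \<inter> {w. 0 < Im w} \<inter> {w. Im w < 3} - {Complex (1/2) (3/2)})"
    by (intro open_Diff open_Int open_halfspace_Re_gt open_halfspace_Re_lt open_halfspace_Im_gt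
          open_halfspace_Im_lt closed_singleton)
  ultimately show ?thesis by simp
qed

lemma roll_period:
  assumes "0 < k" shows "roll k (w + 2 * of_nat k) = roll k w"
proof -
  have "pi * (Re w + 2 * real k - 1/2) / real k = pi * (Re w - 1/2) / real k + 2 * pi"
    using assms by (simp add: field_simps)
  then have "spin k (w + 2 * of_nat k) = spin k w"
    by (simp add: spin_def cis_mult[symmetric])
  then show ?thesis by (simp add: roll_def)
qed

section \<open>The edges of one cell\<close>

definition lattice :: "nat \<times> nat \<Rightarrow> complex" where
  "lattice c = Complex (real (fst c)) (real (snd c))"

text \<open>The end points of the ten edges that belong to a cell, as pairs of column and row. The left side of
  the cell carries \<open>N, a, b, S\<close> in the rows \<open>0, 1, 2, 3\<close>, the right side \<open>N, a', b', S\<close>. The first three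
  entries form the path \<open>N a b S\<close>; the others are the diagonals \<open>a a'\<close>, \<open>b b'\<close>, \<open>a b'\<close>, \<open>b a'\<close>, \<open>a S\<close>,
  \<open>a' S\<close>, \<open>b' N\<close>. The diagonals to a pole end in the middle of the bottom or top line, all of which
  represents that pole.\<close>

definition strand :: "nat \<Rightarrow> (nat \<times> nat) \<times> (nat \<times> nat)" where
  "strand t =
    [((0,0), (0,1)), ((0,1), (0,2)), ((0,2), (0,3)),
     ((0,1), (2,1)), ((0,2), (2,2)), ((0,1), (2,2)), ((0,2), (2,1)),
     ((0,1), (1,3)), ((2,1), (1,3)), ((2,2), (1,0))] ! t"

definition strand_path :: "nat \<Rightarrow> real \<Rightarrow> complex" where
  "strand_path t u = lattice (fst (strand t)) + of_real u * (lattice (snd (strand t)) - lattice (fst (strand t)))"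

text \<open>All intersections of inner points, each listed once with the smaller index first.\<close>

definition strand_crossings :: "(nat \<times> nat \<times> complex) set" where
  "strand_crossings =
    {(3, 9, Complex (3/2) 1), (4, 7, Complex (1/2) 2), (4, 8, Complex (3/2) 2),
     (5, 6, Complex 1 (3/2)), (5, 8, Complex (8/5) (9/5)), (6, 7, Complex (2/5) (9/5)),
     (6, 9, Complex (8/5) (6/5)), (8, 9, Complex (7/4) (3/2))}"

lemma kind_cases:
  fixes t :: nat assumes "t < 10"
  shows "t = 0 \<or> t = 1 \<or> t = 2 \<or> t = 3 \<or> t = 4 \<or> t = 5 \<or> t = 6 \<or> t = 7 \<or> t = 8 \<or> t = 9"
  using assms by presburger

lemma strand_path_0_1:
  "strand_path t 0 = lattice (fst (strand t))" "strand_path t 1 = lattice (snd (strand t))"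
  by (simp_all add: strand_path_def)

lemma strand_path_in_cell:
  assumes "t < 10" "0 \<le> u" "u \<le> 1"
  shows "strand_path t u \<in> cell"
  using kind_cases[OF assms(1)] assms(2,3)
  by (elim disjE) (auto simp: cell_def strand_path_def lattice_def strand_def complex_eq_iff)

text \<open>The removed lattice points are the vertices \<open>a\<close> and \<open>b\<close>; \<open>N\<close> and \<open>S\<close> are excluded by the half-open
  cell. The right side of the cell is excluded too: it belongs to the next cell.\<close>

lemma strand_path_inner:
  assumes "t < 10" "0 < u" "u < 1"
  shows "strand_path t u \<in> half_open_cell - {lattice (0,1), lattice (0,2)}"
  using kind_cases[OF assms(1)] assms(2,3) strand_path_in_cell[of t u]
  by (elim disjE) (auto simp: half_open_cell_def strand_path_def lattice_def strand_def complex_eq_iff)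

lemma strand_path_inj:
  assumes "t < 10" "strand_path t u = strand_path t v" shows "u = v"
  using kind_cases[OF assms(1)] assms(2)
  by (elim disjE) (auto simp: strand_path_def lattice_def strand_def complex_eq_iff)

lemma strand_paths_meet:
  assumes "t < t'" "t' < 10" "0 < u" "u < 1" "0 < v" "v < 1" "strand_path t u = strand_path t' v"
  shows "(t, t', strand_path t u) \<in> strand_crossings"
proof -
  have "t < 10" using assms by simp
  show ?thesis
    using kind_cases[OF \<open>t < 10\<close>] kind_cases[OF assms(2)] assms
    by (elim disjE; simp add: strand_path_def lattice_def strand_def complex_eq_iff strand_crossings_def; linarith)
qed

lemma strand_crossingsE:
  assumes "(t, t', w) \<in> strand_crossings"
  obtains u v where "t < t'" "t' < 10" "0 < u" "u < 1" "0 < v" "v < 1"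
    "w = strand_path t u" "w = strand_path t' v" "w \<in> open_cell"
proof -
  \<comment> \<open>the parameter of \<open>w\<close> on each strand, read off from its real part, as no diagonal is vertical\<close>
  define u where "u = (Re w - Re (strand_path t 0)) / (Re (strand_path t 1) - Re (strand_path t 0))"
  define v where "v = (Re w - Re (strand_path t' 0)) / (Re (strand_path t' 1) - Re (strand_path t' 0))"
  have "t < t' \<and> t' < 10 \<and> 0 < u \<and> u < 1 \<and> 0 < v \<and> v < 1 \<and> w = strand_path t u \<and> w = strand_path t' v
     \<and> w \<in> open_cell"
    using assms unfolding strand_crossings_def
    by (auto simp: u_def v_def strand_path_def strand_def lattice_def complex_eq_iff
        open_cell_def half_open_cell_def cell_def)
  then show thesis using that by blast
qed

definition strands_cross :: "nat \<Rightarrow> nat \<Rightarrow> complex \<Rightarrow> bool" where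
  "strands_cross t s w \<longleftrightarrow> (t, s, w) \<in> strand_crossings \<or> (s, t, w) \<in> strand_crossings"

lemma strands_crossE:
  assumes "strands_cross t s w"
  obtains u v where "t < 10" "s < 10" "t \<noteq> s" "0 < u" "u < 1" "0 < v" "v < 1"
    "w = strand_path t u" "w = strand_path s v" "w \<in> open_cell"
  using assms unfolding strands_cross_def by (auto elim!: strand_crossingsE)

lemma strand_paths_meet_imp_cross:
  assumes "t < 10" "s < 10" "t \<noteq> s" "0 < u" "u < 1" "0 < v" "v < 1" "strand_path t u = strand_path s v"
  shows "strands_cross t s (strand_path t u)"
  using assms strand_paths_meet[of t s u v] strand_paths_meet[of s t v u]
  unfolding strands_cross_def by (cases "t < s") auto

lemma strands_cross_unique_partner:
  "strands_cross t s w \<Longrightarrow> strands_cross t s' w \<Longrightarrow> s = s'"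
  unfolding strands_cross_def strand_crossings_def by auto

lemma strands_cross_unique_point:
  "strands_cross t s w \<Longrightarrow> strands_cross t s w' \<Longrightarrow> w = w'"
  unfolding strands_cross_def strand_crossings_def by auto

lemma strands_cross_transversal:
  assumes "strands_cross t s w"
  shows "Re (lattice (snd (strand t)) - lattice (fst (strand t))) * Im (lattice (snd (strand s)) - lattice (fst (strand s)))
     \<noteq> Im (lattice (snd (strand t)) - lattice (fst (strand t))) * Re (lattice (snd (strand s)) - lattice (fst (strand s)))"
  using assms unfolding strands_cross_def strand_crossings_def
  by (auto simp: strand_def lattice_def)

lemma strands_cross_ex:
  assumes "3 \<le> t" "t < 10" shows "\<exists>s w. strands_cross t s w"
  using kind_cases[OF assms(2)] assms(1) unfolding strands_cross_def strand_crossings_def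
  by (elim disjE) auto

definition strand_color :: "nat \<Rightarrow> nat" where
  "strand_color t = [1, 1, 1, 1, 1, 3, 3, 1, 2, 2] ! t"

lemma strand_color_range:
  assumes "t < 10" shows "strand_color t \<in> {1..3}"
  using kind_cases[OF assms] by (elim disjE) (auto simp: strand_color_def)

lemma strands_crossing_one_strand_differ_in_color:
  "strands_cross t s w \<Longrightarrow> strands_cross t s' w' \<Longrightarrow> strand_color s = strand_color s' \<Longrightarrow> s = s'"
  unfolding strands_cross_def strand_crossings_def
  by (auto simp: strand_color_def)

lemma card_strand_crossing_points: "card ((snd \<circ> snd) ` strand_crossings) = 8"
  by (simp add: strand_crossings_def)

section \<open>Vertices and their representatives in a cell\<close>

definition corners :: "nat \<Rightarrow> (nat \<times> nat) set" where
  "corners t = {fst (strand t), snd (strand t)}"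

text \<open>The numbering is \<open>N = 0\<close>, \<open>S = 1\<close>, \<open>a\<^sub>i = 2i + 2\<close>, \<open>b\<^sub>i = 2i + 3\<close>. The column \<open>1\<close> occurs only in the
  rows \<open>0\<close> and \<open>3\<close>, so \<open>fst c div 2\<close> tells the left from the right side of the cell \<open>i\<close>.\<close>

definition vertex_at :: "nat \<Rightarrow> nat \<Rightarrow> nat \<times> nat \<Rightarrow> nat" where
  "vertex_at k i c = (if snd c = 0 then 0 else if snd c = 3 then 1
     else 1 + snd c + 2 * ((i + fst c div 2) mod k))"

definition vertex_position :: "nat \<Rightarrow> nat \<Rightarrow> complex" where
  "vertex_position k v = (if v = 0 then 0 else if v = 1 then 1
     else roll k (cell_point ((v - 2) div 2) (lattice (0, 1 + v mod 2))))"

lemma strand_corners: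
  assumes "t < 10" "c \<in> corners t"
  shows "snd c \<le> 3" "0 < snd c \<Longrightarrow> snd c < 3 \<Longrightarrow> fst c = 0 \<or> fst c = 2"
  using kind_cases[OF assms(1)] assms(2) by (elim disjE; auto simp: corners_def strand_def)+

lemma vertex_at_less:
  assumes "0 < k" "t < 10" "c \<in> corners t"
  shows "vertex_at k i c < 2 * k + 2"
proof -
  have "(i + fst c div 2) mod k < k" using assms(1) by simp
  moreover have "snd c \<le> 3" using strand_corners[OF assms(2,3)] by simp
  ultimately show ?thesis unfolding vertex_at_def by auto
qed

text \<open>For a corner on the right side of the last cell the index of the vertex wraps around to \<open>0\<close>, in
  accordance with the period of \<open>roll\<close>.\<close>

lemma vertex_position_vertex_at:
  assumes "i < k" "t < 10" "c \<in> corners t"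
  shows "vertex_position k (vertex_at k i c) = roll k (cell_point i (lattice c))"
proof -
  consider "snd c = 0" | "snd c = 3" | "snd c = 1 \<or> snd c = 2" "fst c = 0 \<or> fst c = 2"
    using strand_corners[OF assms(2,3)] by linarith
  then show ?thesis
  proof cases
    case 1
    then show ?thesis by (simp add: vertex_at_def vertex_position_def roll_bottom lattice_def)
  next
    case 2
    then show ?thesis by (simp add: vertex_at_def vertex_position_def roll_top lattice_def)
  next
    case 3
    define m where "m = (i + fst c div 2) mod k"
    have "vertex_position k (vertex_at k i c) = roll k (cell_point m (lattice (0, snd c)))"
      using 3(1) by (auto simp: vertex_at_def vertex_position_def m_def[symmetric] numeral_2_eq_2[symmetric])
    also have "\<dots> = roll k (cell_point i (lattice c))"
    proof (cases "fst c = 2 \<and> Suc i = k")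
      case True
      then have "m = 0" by (simp add: m_def)
      have "cell_point i (lattice c) = cell_point 0 (lattice (0, snd c)) + 2 * of_nat k"
        using True by (auto simp: complex_eq_iff lattice_def)
      then show ?thesis using \<open>m = 0\<close> roll_period[of k] assms(1) by simp
    next
      case False
      then have "cell_point m (lattice (0, snd c)) = cell_point i (lattice c)"
        using 3(2) assms(1) by (auto simp: complex_eq_iff lattice_def m_def)
      then show ?thesis by simp
    qed
    finally show ?thesis .
  qed
qed

lemma lattice_in_half_open_cell: "lattice (0, 1 + v mod 2) \<in> half_open_cell"
proof -
  have "v mod 2 = 0 \<or> v mod 2 = 1" by auto
  then show ?thesis
    by (auto simp: lattice_def half_open_cell_def cell_def)
qed

lemma inj_on_vertex_position:
  assumes "0 < k" shows "inj_on (vertex_position k) {..<2 * k + 2}"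
proof (rule inj_onI)
  fix v v' assume v: "v \<in> {..<2 * k + 2}" "v' \<in> {..<2 * k + 2}" and eq: "vertex_position k v = vertex_position k v'"
  have off: "vertex_position k x \<notin> {0, 1}" if "2 \<le> x" for x
    using roll_avoids_poles[OF assms lattice_in_half_open_cell] that
    by (simp add: vertex_position_def)
  have low: "vertex_position k x = of_nat x" if "x < 2" for x
  proof -
    have "x = 0 \<or> x = 1" using that by auto
    then show ?thesis by (auto simp: vertex_position_def)
  qed
  consider "v < 2" "v' < 2" | "v < 2" "2 \<le> v'" | "2 \<le> v" "v' < 2" | "2 \<le> v" "2 \<le> v'" by linarith
  then show "v = v'"
  proof cases
    case 1 then show ?thesis using eq low by simp
  next
    case 2
    then have "vertex_position k v \<in> {0, 1}" by (cases "v = 0") (auto simp: low)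
    then show ?thesis using eq off 2 by metis
  next
    case 3
    then have "vertex_position k v' \<in> {0, 1}" by (cases "v' = 0") (auto simp: low)
    then show ?thesis using eq off 3 by metis
  next
    case 4
    then have "(v - 2) div 2 < k" "(v' - 2) div 2 < k" using v by auto
    moreover have "roll k (cell_point ((v - 2) div 2) (lattice (0, 1 + v mod 2)))
        = roll k (cell_point ((v' - 2) div 2) (lattice (0, 1 + v' mod 2)))"
      using eq 4 by (simp add: vertex_position_def)
    ultimately have "(v - 2) div 2 = (v' - 2) div 2" "lattice (0, 1 + v mod 2) = lattice (0, 1 + v' mod 2)"
      using roll_half_open_eqD lattice_in_half_open_cell by blast+
    then have "(v - 2) div 2 = (v' - 2) div 2" "v mod 2 = v' mod 2"
      by (auto simp: lattice_def)
    moreover have "x = 2 * ((x - 2) div 2) + 2 + x mod 2" if "2 \<le> x" for x :: nat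
      using that by presburger
    ultimately show ?thesis using 4 by metis
  qed
qed

text \<open>Vertices other than the poles are represented by points on the left side of a half-open cell, where
  \<open>roll\<close> is injective, so it suffices that no strand runs through these points.\<close>

lemma strand_inner_not_vertex:
  assumes "i < k" "t < 10" "0 < u" "u < 1"
  shows "roll k (cell_point i (strand_path t u)) \<notin> vertex_position k ` {..<2 * k + 2}"
proof
  define w where "w = strand_path t u"
  have w: "w \<in> half_open_cell" "w \<noteq> lattice (0, 1)" "w \<noteq> lattice (0, 2)"
    using strand_path_inner[OF assms(2-4)] by (auto simp: w_def)
  assume "roll k (cell_point i (strand_path t u)) \<in> vertex_position k ` {..<2 * k + 2}"
  then obtain v where v: "v < 2 * k + 2" "roll k (cell_point i w) = vertex_position k v"
    by (auto simp: w_def)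
  have k: "0 < k" using assms by simp
  have "roll k (cell_point i w) \<notin> {0, 1}" by (rule roll_avoids_poles[OF k w(1)])
  then have v2: "2 \<le> v" and "vertex_position k v = roll k (cell_point ((v - 2) div 2) (lattice (0, 1 + v mod 2)))"
    using v by (auto simp: vertex_position_def split: if_splits)
  moreover have "(v - 2) div 2 < k" using v(1) v2 by auto
  ultimately have "w = lattice (0, 1 + v mod 2)"
    using roll_half_open_eqD[OF assms(1) _ w(1) lattice_in_half_open_cell, of "(v - 2) div 2" v] v(2) by simp
  moreover have "v mod 2 = 0 \<or> v mod 2 = 1" by auto
  ultimately show False using w(2,3) by (auto simp: numeral_2_eq_2)
qed

lemma succ_mod_neq: "2 \<le> k \<Longrightarrow> i < k \<Longrightarrow> Suc i mod k \<noteq> i" for i k :: nat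
  by (cases "Suc i = k") auto

text \<open>Vertices in the rows \<open>1\<close> and \<open>2\<close> are told apart by their parity.\<close>

lemma add_double_cancel:
  "p + 2 * a = q + 2 * b \<Longrightarrow> 0 < p \<Longrightarrow> p < 3 \<Longrightarrow> 0 < q \<Longrightarrow> q < 3 \<Longrightarrow> p = q" for p q a b :: nat
  by presburger

lemma vertex_at_eqD:
  assumes t: "t < 10" "s < 10" and c: "c \<in> corners t" "c' \<in> corners s"
    and eq: "vertex_at k i c = vertex_at k j c'"
  shows "snd c = snd c'"
    and "0 < snd c \<Longrightarrow> snd c < 3 \<Longrightarrow> (i + fst c div 2) mod k = (j + fst c' div 2) mod k"
proof -
  have "snd c \<le> 3" "snd c' \<le> 3" using strand_corners t c by auto
  then show row: "snd c = snd c'"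
    using eq add_double_cancel[of "snd c" "(i + fst c div 2) mod k" "snd c'" "(j + fst c' div 2) mod k"]
    unfolding vertex_at_def by (simp split: if_splits)
  show "(i + fst c div 2) mod k = (j + fst c' div 2) mod k" if "0 < snd c" "snd c < 3"
    using eq that row unfolding vertex_at_def by simp
qed

text \<open>Because there are at least two cells, the left and the right side of a cell carry different vertices;
  only the poles are represented several times.\<close>

lemma vertex_at_same_cell:
  assumes k: "2 \<le> k" "i < k" and t: "t < 10" "s < 10" and c: "c \<in> corners t" "c' \<in> corners s"
    and eq: "vertex_at k i c = vertex_at k i c'"
  shows "snd c = snd c' \<and> (0 < snd c \<and> snd c < 3 \<longrightarrow> fst c = fst c')"
proof -
  note corner = strand_corners[OF t(1) c(1)] strand_corners[OF t(2) c(2)]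
  note D = vertex_at_eqD[OF t c eq]
  have "fst c = fst c'" if mid: "0 < snd c" "snd c < 3"
  proof -
    have "fst c = 0 \<or> fst c = 2" "fst c' = 0 \<or> fst c' = 2"
      using corner mid D(1) by auto
    then show ?thesis using D(2)[OF mid] succ_mod_neq[OF k] k(2) by auto
  qed
  then show ?thesis using D(1) by blast
qed

lemma crossing_strands_no_common_corner:
  assumes "strands_cross t s w" "c \<in> corners t" "c' \<in> corners s"
  shows "\<not> (snd c = snd c' \<and> (0 < snd c \<and> snd c < 3 \<longrightarrow> fst c = fst c'))"
  using assms unfolding strands_cross_def strand_crossings_def by (auto simp: corners_def strand_def)

lemma corners_determine_strand:
  assumes "t < 10" "s < 10"
    and "\<forall>c\<in>corners t. \<exists>c'\<in>corners s. snd c = snd c' \<and> (0 < snd c \<and> snd c < 3 \<longrightarrow> fst c = fst c')"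
  shows "t = s"
  using kind_cases[OF assms(1)] kind_cases[OF assms(2)] assms(3)
  by (elim disjE) (simp_all add: corners_def strand_def)

definition strand_ends :: "nat \<Rightarrow> nat \<Rightarrow> nat \<Rightarrow> nat set" where
  "strand_ends k i t = vertex_at k i ` corners t"

lemma strand_ends_same_cell:
  assumes "2 \<le> k" "i < k" "t < 10" "s < 10" "strand_ends k i t = strand_ends k i s"
  shows "t = s"
proof (rule corners_determine_strand[OF assms(3,4)], rule ballI)
  fix c assume c: "c \<in> corners t"
  then have "vertex_at k i c \<in> strand_ends k i s"
    using assms(5) unfolding strand_ends_def by blast
  then obtain c' where "c' \<in> corners s" "vertex_at k i c = vertex_at k i c'"
    unfolding strand_ends_def by blast
  then show "\<exists>c'\<in>corners s. snd c = snd c' \<and> (0 < snd c \<and> snd c < 3 \<longrightarrow> fst c = fst c')"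
    using vertex_at_same_cell[OF assms(1-4) c] by blast
qed

lemma strand_ends_disjoint:
  assumes "2 \<le> k" "i < k" "strands_cross t s w"
  shows "strand_ends k i t \<inter> strand_ends k i s = {}"
proof (rule ccontr)
  assume "strand_ends k i t \<inter> strand_ends k i s \<noteq> {}"
  then obtain c c' where c: "c \<in> corners t" "c' \<in> corners s" "vertex_at k i c = vertex_at k i c'"
    unfolding strand_ends_def by blast
  have "t < 10" "s < 10" using assms(3) by (auto elim: strands_crossE)
  then show False
    using vertex_at_same_cell[OF assms(1,2) _ _ c] crossing_strands_no_common_corner[OF assms(3) c(1,2)] by blast
qed

lemma card_strand_ends:
  assumes "2 \<le> k" "i < k" "t < 10" shows "card (strand_ends k i t) = 2"
proof -
  have "vertex_at k i (fst (strand t)) \<noteq> vertex_at k i (snd (strand t))"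
  proof
    assume "vertex_at k i (fst (strand t)) = vertex_at k i (snd (strand t))"
    from vertex_at_same_cell[OF assms(1-3) assms(3) _ _ this] show False
      using kind_cases[OF assms(3)] by (elim disjE) (simp_all add: corners_def strand_def)
  qed
  then show ?thesis by (simp add: strand_ends_def corners_def)
qed

lemma corner_rows_left_corner:
  assumes "t < 3" "s < 10" "snd ` corners t = snd ` corners s"
  shows "\<exists>c\<in>corners s. 0 < snd c \<and> snd c < 3 \<and> fst c = 0"
proof -
  have "t = 0 \<or> t = 1 \<or> t = 2" using assms(1) by auto
  then show ?thesis
    using kind_cases[OF assms(2)] assms(3)
    by (elim disjE) (simp_all add: corners_def strand_def doubleton_eq_iff)
qed

lemma corner_left: "t < 3 \<Longrightarrow> c \<in> corners t \<Longrightarrow> fst c = 0"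
  by (auto simp: less_Suc_eq numeral_3_eq_3 corners_def strand_def)

text \<open>A strand joining the same two rows as a path edge has an end on the left side of its cell in one of
  the rows \<open>1\<close> and \<open>2\<close>. This end determines the cell, and the ends of path edges are on the left as well.\<close>

lemma path_strand_ends_unique:
  assumes "i < k" "j < k" "t < 3" "s < 10" "strand_ends k i t = strand_ends k j s"
  shows "i = j"
proof -
  have t: "t < 10" using assms(3) by simp
  have match: "\<exists>c\<in>corners t. vertex_at k i c = vertex_at k j c'" if "c' \<in> corners s" for c'
    using that assms(5) unfolding strand_ends_def by (metis imageE imageI)
  have match': "\<exists>c'\<in>corners s. vertex_at k i c = vertex_at k j c'" if "c \<in> corners t" for c
    using that assms(5) unfolding strand_ends_def by (metis imageE imageI)
  have "snd ` corners t = snd ` corners s"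
  proof
    show "snd ` corners t \<subseteq> snd ` corners s"
      using match' vertex_at_eqD(1)[OF t assms(4)] by (metis image_subsetI imageI)
    show "snd ` corners s \<subseteq> snd ` corners t"
      using match vertex_at_eqD(1)[OF t assms(4)] by (metis image_subsetI imageI)
  qed
  then obtain c' where c': "c' \<in> corners s" "0 < snd c'" "snd c' < 3" "fst c' = 0"
    using corner_rows_left_corner[OF assms(3,4)] by blast
  then obtain c where c: "c \<in> corners t" "vertex_at k i c = vertex_at k j c'"
    using match by blast
  have "fst c = 0" using corner_left[OF assms(3) c(1)] .
  then show ?thesis
    using vertex_at_eqD[OF t assms(4) c(1) c'(1) c(2)] c' assms(1,2) by simp
qed

section \<open>The drawing\<close>

text \<open>The edge \<open>10 i + t\<close> is the strand \<open>t\<close> of the cell \<open>i\<close>.\<close>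

definition theta_graph :: "nat \<Rightarrow> (nat, nat) multigraph" where
  "theta_graph k = \<lparr>verts = {..<2 * k + 2}, edges = {..<10 * k},
     ends = (\<lambda>e. strand_ends k (e div 10) (e mod 10))\<rparr>"

definition edge_chart :: "nat \<Rightarrow> nat \<Rightarrow> complex \<Rightarrow> complex" where
  "edge_chart k e w = roll k (cell_point (e div 10) w)"

definition theta_drawing :: "nat \<Rightarrow> (nat, nat) drawing" where
  "theta_drawing k = \<lparr>point = vertex_position k,
     curve = (\<lambda>e u. edge_chart k e (strand_path (e mod 10) u))\<rparr>"

lemma theta_sel [simp]:
  "verts (theta_graph k) = {..<2 * k + 2}"
  "edges (theta_graph k) = {..<10 * k}"
  "ends (theta_graph k) e = strand_ends k (e div 10) (e mod 10)"
  "point (theta_drawing k) = vertex_position k"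
  "curve (theta_drawing k) e u = edge_chart k e (strand_path (e mod 10) u)"
  by (simp_all add: theta_graph_def theta_drawing_def)

lemma edge_eqI: "e div 10 = f div 10 \<Longrightarrow> e mod 10 = f mod 10 \<Longrightarrow> e = f" for e f :: nat
  by (metis div_mult_mod_eq)

lemma edge_cell: "e < 10 * k \<Longrightarrow> e div 10 < k" for e k :: nat
  by (simp add: less_mult_imp_div_less mult.commute)

context
  fixes k :: nat
  assumes k: "2 \<le> k"
begin

lemma k_pos: "0 < k" using k by simp

lemma wf_theta_graph: "wf_multigraph (theta_graph k)"
proof -
  have "strand_ends k (e div 10) (e mod 10) \<subseteq> {..<2 * k + 2}" for e
    using vertex_at_less[OF k_pos, of "e mod 10"] by (auto simp: strand_ends_def)
  then show ?thesis
    using card_strand_ends[OF k edge_cell] by (auto simp: wf_multigraph_def)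
qed

lemma edge_chart_inj:
  assumes "e < 10 * k" "f < 10 * k" "w \<in> half_open_cell" "v \<in> half_open_cell"
    and "edge_chart k e w = edge_chart k f v"
  shows "e div 10 = f div 10 \<and> w = v"
  using roll_half_open_eqD[OF edge_cell[OF assms(1)] edge_cell[OF assms(2)] assms(3,4)] assms(5)
  by (simp add: edge_chart_def)

lemma continuous_on_edge_chart: "continuous_on cell (edge_chart k e)"
proof -
  have "continuous_on cell (cell_point (e div 10))"
    unfolding cell_point_def by (intro continuous_intros)
  then have "continuous_on cell (roll k \<circ> cell_point (e div 10))"
    using cell_point_in_strip[OF k_pos]
    by (intro continuous_on_compose continuous_on_subset[OF continuous_on_roll[OF k_pos]]) auto
  then show ?thesis by (simp add: edge_chart_def[abs_def] comp_def)
qed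

lemma strand_path_half_open: "0 < u \<Longrightarrow> u < 1 \<Longrightarrow> strand_path (e mod 10) u \<in> half_open_cell"
  using strand_path_inner[of "e mod 10" u] by simp

lemma edge_chart_corner:
  assumes "e < 10 * k" "c \<in> corners (e mod 10)"
  shows "edge_chart k e (lattice c) = vertex_position k (vertex_at k (e div 10) c)"
  using vertex_position_vertex_at[OF edge_cell[OF assms(1)] _ assms(2)] by (simp add: edge_chart_def)

lemma curve_end_vertex:
  assumes "e < 10 * k" "u = 0 \<or> u = 1"
  shows "edge_chart k e (strand_path (e mod 10) u) \<in> vertex_position k ` {..<2 * k + 2}"
proof -
  obtain c where c: "c \<in> corners (e mod 10)" "strand_path (e mod 10) u = lattice c"
    using assms(2) strand_path_0_1[of "e mod 10"] unfolding corners_def by blast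
  have "vertex_at k (e div 10) c < 2 * k + 2"
    using vertex_at_less[OF k_pos _ c(1)] by simp
  then show ?thesis unfolding c(2) edge_chart_corner[OF assms(1) c(1)] by simp
qed

lemma curve_inner_not_vertex:
  assumes "e < 10 * k" "0 < u" "u < 1"
  shows "edge_chart k e (strand_path (e mod 10) u) \<notin> vertex_position k ` {..<2 * k + 2}"
  using strand_inner_not_vertex[OF edge_cell[OF assms(1)] _ assms(2,3)] by (simp add: edge_chart_def)

lemma curve_ends:
  assumes "e < 10 * k"
  shows "{pathstart (curve (theta_drawing k) e), pathfinish (curve (theta_drawing k) e)}
    = vertex_position k ` strand_ends k (e div 10) (e mod 10)"
proof -
  have "fst (strand (e mod 10)) \<in> corners (e mod 10)" "snd (strand (e mod 10)) \<in> corners (e mod 10)"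
    by (auto simp: corners_def)
  from this[THEN edge_chart_corner[OF assms]] show ?thesis
    by (simp add: pathstart_def pathfinish_def strand_path_0_1 strand_ends_def corners_def)
qed

text \<open>Inner points are distinguished by the injectivity of \<open>roll\<close> on half-open cells, and from the ends by not
  being vertices; the two ends are different vertices.\<close>

lemma arc_curve:
  assumes "e < 10 * k"
  shows "arc (curve (theta_drawing k) e)"
proof -
  let ?s = "strand_path (e mod 10)"
  have curve: "curve (theta_drawing k) e = edge_chart k e \<circ> ?s" by (simp add: fun_eq_iff)
  have "continuous_on {0..1} ?s" unfolding strand_path_def by (intro continuous_intros)
  moreover have "?s ` {0..1} \<subseteq> cell" using strand_path_in_cell[of "e mod 10"] by auto
  ultimately have "continuous_on {0..1} (edge_chart k e \<circ> ?s)"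
    by (intro continuous_on_compose continuous_on_subset[OF continuous_on_edge_chart])
  moreover have "inj_on (edge_chart k e \<circ> ?s) {0..1}"
  proof (rule linorder_inj_onI')
    fix u v :: real assume u: "u \<in> {0..1}" and v: "v \<in> {0..1}" and "u < v"
    show "(edge_chart k e \<circ> ?s) u \<noteq> (edge_chart k e \<circ> ?s) v"
    proof
      assume eq: "(edge_chart k e \<circ> ?s) u = (edge_chart k e \<circ> ?s) v"
      consider "0 < u" "v < 1" | "0 < u" "v = 1" | "u = 0" "v < 1" | "u = 0" "v = 1"
        using u v by fastforce
      then show False
      proof cases
        case 1
        then have "?s u = ?s v"
          using edge_chart_inj[OF assms assms strand_path_half_open strand_path_half_open] eq \<open>u < v\<close> by auto
        then have "u = v" using strand_path_inj[of "e mod 10" u v] by simp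
        then show False using \<open>u < v\<close> by simp
      next
        case 2
        then show False
          using curve_inner_not_vertex[OF assms, of u] curve_end_vertex[OF assms, of v] eq \<open>u < v\<close> by simp
      next
        case 3
        then show False
          using curve_inner_not_vertex[OF assms, of v] curve_end_vertex[OF assms, of u] eq \<open>u < v\<close> by simp
      next
        case 4
        have "card (strand_ends k (e div 10) (e mod 10)) = 2"
          using card_strand_ends[OF k edge_cell[OF assms]] by simp
        moreover have "strand_ends k (e div 10) (e mod 10) \<subseteq> {..<2 * k + 2}"
          using vertex_at_less[OF k_pos, of "e mod 10"] by (auto simp: strand_ends_def)
        ultimately have "card (vertex_position k ` strand_ends k (e div 10) (e mod 10)) = 2"
          using inj_on_vertex_position[OF k_pos] by (metis card_image inj_on_subset)
        then show False
          unfolding curve_ends[OF assms, symmetric] using eq 4 by (simp add: pathstart_def pathfinish_def)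
      qed
    qed
  qed
  ultimately show ?thesis unfolding arc_def path_def curve by simp
qed

lemma edge_inner_theta:
  assumes "e < 10 * k"
  shows "edge_inner (theta_drawing k) e = (\<lambda>u. edge_chart k e (strand_path (e mod 10) u)) ` {0<..<1}"
  unfolding edge_inner_def path_image_minus_ends[OF arc_curve[OF assms]] by simp

lemma edge_inner_Int_theta:
  assumes e: "e < 10 * k" and f: "f < 10 * k" and "e \<noteq> f"
    and x: "x \<in> edge_inner (theta_drawing k) e \<inter> edge_inner (theta_drawing k) f"
  obtains w where "e div 10 = f div 10" "strands_cross (e mod 10) (f mod 10) w" "x = edge_chart k e w"
proof -
  obtain u v where u: "0 < u" "u < 1" "x = edge_chart k e (strand_path (e mod 10) u)"
    and v: "0 < v" "v < 1" "x = edge_chart k f (strand_path (f mod 10) v)"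
    using x edge_inner_theta[OF e] edge_inner_theta[OF f] by auto
  have *: "e div 10 = f div 10" "strand_path (e mod 10) u = strand_path (f mod 10) v"
    using edge_chart_inj[OF e f strand_path_half_open[OF u(1,2), of e] strand_path_half_open[OF v(1,2), of f]] u(3) v(3)
    by auto
  then have "e mod 10 \<noteq> f mod 10" using \<open>e \<noteq> f\<close> edge_eqI by blast
  then show thesis
    using that[OF *(1) strand_paths_meet_imp_cross[OF _ _ _ u(1,2) v(1,2) *(2)] u(3)] by simp
qed

lemma strands_cross_edge_inner:
  assumes e: "e < 10 * k" and f: "f < 10 * k" and "e div 10 = f div 10"
    and cr: "strands_cross (e mod 10) (f mod 10) w"
  shows "edge_chart k e w \<in> edge_inner (theta_drawing k) e \<inter> edge_inner (theta_drawing k) f"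
proof -
  obtain u v where uv: "0 < u" "u < 1" "0 < v" "v < 1"
    "w = strand_path (e mod 10) u" "w = strand_path (f mod 10) v"
    using cr by (rule strands_crossE)
  have "edge_chart k e w = edge_chart k f w" using assms(3) by (simp add: edge_chart_def)
  then show ?thesis
    unfolding edge_inner_theta[OF e] edge_inner_theta[OF f]
    using uv by (intro IntI image_eqI[of _ _ u] image_eqI[of _ _ v]) auto
qed

text \<open>The chart is injective on the half-open cell but not on the closed one, so an end of the strand could
  be identified with a point of the open cell; this does not happen since the representatives of the
  vertices are on the boundary.\<close>

lemma edge_image_near_cell:
  assumes e: "e < 10 * k" and "e div 10 = f div 10" and f: "f < 10 * k"
  shows "edge_image (theta_drawing k) e \<inter> edge_chart k f ` open_cell
    = edge_chart k f ` (open_cell \<inter> strand_path (e mod 10) ` {0..1})"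
proof -
  have same: "edge_chart k f = edge_chart k e" using assms(2) by (simp add: edge_chart_def[abs_def])
  have "strand_path (e mod 10) u \<in> open_cell"
    if u: "u \<in> {0..1}" and w: "w \<in> open_cell" and eq: "edge_chart k e (strand_path (e mod 10) u) = edge_chart k e w" for u w
  proof -
    have wh: "w \<in> half_open_cell" using w by (simp add: open_cell_def)
    show ?thesis
    proof (cases "u = 0 \<or> u = 1")
      case False
      then have "strand_path (e mod 10) u \<in> half_open_cell" using u by (intro strand_path_half_open) auto
      then show ?thesis using edge_chart_inj[OF e e _ wh eq] w by simp
    next
      case True
      then obtain v where v: "v < 2 * k + 2" "edge_chart k e w = vertex_position k v"
        using curve_end_vertex[OF e True] eq by auto
      have "edge_chart k e w \<notin> {0, 1}"
        unfolding edge_chart_def using roll_avoids_poles[OF k_pos wh] .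
      then have v2: "2 \<le> v" using v(2) by (auto simp: vertex_position_def split: if_splits)
      then have "edge_chart k e w = edge_chart k (10 * ((v - 2) div 2)) (lattice (0, 1 + v mod 2))"
        using v(2) by (simp add: vertex_position_def edge_chart_def)
      moreover have "10 * ((v - 2) div 2) < 10 * k" using v(1) v2 by auto
      ultimately have "w = lattice (0, 1 + v mod 2)"
        using edge_chart_inj[OF e _ wh lattice_in_half_open_cell] by blast
      then show ?thesis using w by (simp add: open_cell_def lattice_def)
    qed
  qed
  then show ?thesis unfolding same path_image_def by auto
qed

lemma crosses_at_theta:
  assumes e: "e < 10 * k" and f: "f < 10 * k" and "e div 10 = f div 10"
    and cr: "strands_cross (e mod 10) (f mod 10) w"
  shows "crosses_at (edge_image (theta_drawing k) e) (edge_image (theta_drawing k) f) (edge_chart k e w)"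
proof -
  obtain u v where uv: "0 < u" "u < 1" "0 < v" "v < 1"
    "w = strand_path (e mod 10) u" "w = strand_path (f mod 10) v" "w \<in> open_cell"
    using cr by (rule strands_crossE)
  have sub: "open_cell \<subseteq> half_open_cell" "half_open_cell \<subseteq> cell"
    by (auto simp: open_cell_def half_open_cell_def)
  have "continuous_on open_cell (edge_chart k e)"
    using sub by (intro continuous_on_subset[OF continuous_on_edge_chart]) auto
  moreover have "inj_on (edge_chart k e) open_cell"
    using edge_chart_inj[OF e e] sub by (auto intro!: inj_onI)
  ultimately show ?thesis
    using uv strands_cross_transversal[OF cr]
      edge_image_near_cell[OF e refl e] edge_image_near_cell[OF f assms(3)[symmetric] e]
    by (intro crosses_at_image[OF open_open_cell _ _ uv(7), of _ "lattice (fst (strand (e mod 10)))" u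
          "lattice (snd (strand (e mod 10))) - lattice (fst (strand (e mod 10)))"
          "lattice (fst (strand (f mod 10)))" v
          "lattice (snd (strand (f mod 10))) - lattice (fst (strand (f mod 10)))"])
       (simp_all add: strand_path_def[abs_def])
qed

lemma edge_inner_Int_eq_crossing_points:
  assumes "e < 10 * k" "f < 10 * k" "e \<noteq> f"
  shows "edge_inner (theta_drawing k) e \<inter> edge_inner (theta_drawing k) f = crossing_points (theta_drawing k) e f"
proof -
  have "crosses_at (edge_image (theta_drawing k) e) (edge_image (theta_drawing k) f) x"
    if "x \<in> edge_inner (theta_drawing k) e \<inter> edge_inner (theta_drawing k) f" for x
    using edge_inner_Int_theta[OF assms that] crosses_at_theta[OF assms(1,2)] by metis
  then show ?thesis unfolding crossing_points_def by auto
qed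

lemma edges_cross_once:
  assumes "e < 10 * k" "f < 10 * k" "e \<noteq> f"
    and "x \<in> edge_inner (theta_drawing k) e \<inter> edge_inner (theta_drawing k) f"
    and "y \<in> edge_inner (theta_drawing k) e \<inter> edge_inner (theta_drawing k) f"
  shows "x = y"
  using edge_inner_Int_theta[OF assms(1-3,4)] edge_inner_Int_theta[OF assms(1-3,5)]
    strands_cross_unique_point by metis

lemma no_triple_crossing:
  assumes efg: "e < 10 * k" "f < 10 * k" "g < 10 * k" and ne: "e \<noteq> f" "f \<noteq> g" "e \<noteq> g"
  shows "edge_inner (theta_drawing k) e \<inter> edge_inner (theta_drawing k) f \<inter> edge_inner (theta_drawing k) g = {}"
proof (rule ccontr)
  assume "\<not> ?thesis"
  then obtain x where x: "x \<in> edge_inner (theta_drawing k) e \<inter> edge_inner (theta_drawing k) f"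
    "x \<in> edge_inner (theta_drawing k) e \<inter> edge_inner (theta_drawing k) g" by blast
  obtain w where w: "e div 10 = f div 10" "strands_cross (e mod 10) (f mod 10) w" "x = edge_chart k e w"
    using edge_inner_Int_theta[OF efg(1,2) ne(1) x(1)] .
  obtain v where v: "e div 10 = g div 10" "strands_cross (e mod 10) (g mod 10) v" "x = edge_chart k e v"
    using edge_inner_Int_theta[OF efg(1,3) ne(3) x(2)] .
  have "w \<in> half_open_cell" "v \<in> half_open_cell"
    using w(2) v(2) by (auto elim!: strands_crossE simp: open_cell_def)
  then have "w = v" using edge_chart_inj[OF efg(1,1)] w(3) v(3) by blast
  then have "f mod 10 = g mod 10" using strands_cross_unique_partner w(2) v(2) by blast
  then show False using w(1) v(1) ne(2) edge_eqI by metis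
qed

lemma adjacent_edges_do_not_cross:
  assumes ef: "e < 10 * k" "f < 10 * k" "e \<noteq> f"
    and adj: "strand_ends k (e div 10) (e mod 10) \<inter> strand_ends k (f div 10) (f mod 10) \<noteq> {}"
  shows "edge_inner (theta_drawing k) e \<inter> edge_inner (theta_drawing k) f = {}"
proof (rule ccontr)
  assume "\<not> ?thesis"
  then obtain x where x: "x \<in> edge_inner (theta_drawing k) e \<inter> edge_inner (theta_drawing k) f" by blast
  show False
    using edge_inner_Int_theta[OF ef x] strand_ends_disjoint[OF k edge_cell[OF ef(1)]] adj by metis
qed

lemma is_drawing_theta: "is_drawing (theta_graph k) (theta_drawing k)"
proof -
  have "finite (edge_image (theta_drawing k) e \<inter> edge_image (theta_drawing k) f)"
    if ef: "e < 10 * k" "f < 10 * k" "e \<noteq> f" for e f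
  proof -
    have "finite (edge_inner (theta_drawing k) e \<inter> edge_inner (theta_drawing k) f)"
    proof (cases "edge_inner (theta_drawing k) e \<inter> edge_inner (theta_drawing k) f = {}")
      case False
      then obtain x where "x \<in> edge_inner (theta_drawing k) e \<inter> edge_inner (theta_drawing k) f" by blast
      then have "edge_inner (theta_drawing k) e \<inter> edge_inner (theta_drawing k) f \<subseteq> {x}"
        using edges_cross_once[OF ef] by blast
      then show ?thesis by (rule finite_subset) simp
    qed simp
    then have "finite (edge_inner (theta_drawing k) e \<inter> edge_inner (theta_drawing k) f \<union>
      {pathstart (curve (theta_drawing k) e), pathfinish (curve (theta_drawing k) e),
       pathstart (curve (theta_drawing k) f), pathfinish (curve (theta_drawing k) f)})"
      by simp
    then show ?thesis by (rule rev_finite_subset) (auto simp: edge_inner_def)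
  qed
  moreover have "edge_inner (theta_drawing k) e \<inter> vertex_position k ` {..<2 * k + 2} = {}" if e: "e < 10 * k" for e
  proof (rule equals0I)
    fix x assume x: "x \<in> edge_inner (theta_drawing k) e \<inter> vertex_position k ` {..<2 * k + 2}"
    then obtain u where u: "0 < u" "u < 1" "x = edge_chart k e (strand_path (e mod 10) u)"
      using edge_inner_theta[OF e] by auto
    show False using curve_inner_not_vertex[OF e u(1,2)] IntD2[OF x, unfolded u(3)] by contradiction
  qed
  ultimately show ?thesis
    unfolding is_drawing_def
    using inj_on_vertex_position[OF k_pos] arc_curve curve_ends
      edge_inner_Int_eq_crossing_points adjacent_edges_do_not_cross no_triple_crossing
    by simp
qed

text \<open>Two strands of one cell never have the same ends, and a path edge has no parallel edge.\<close>

lemma parallel_edges: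
  assumes ef: "e < 10 * k" "f < 10 * k" "e \<noteq> f"
    and par: "strand_ends k (e div 10) (e mod 10) = strand_ends k (f div 10) (f mod 10)"
  shows "e div 10 \<noteq> f div 10" "3 \<le> e mod 10"
proof -
  show ne: "e div 10 \<noteq> f div 10"
  proof
    assume same: "e div 10 = f div 10"
    then have "e mod 10 = f mod 10"
      using strand_ends_same_cell[OF k edge_cell[OF ef(1)], of "e mod 10" "f mod 10"] par by simp
    then show False using same ef(3) edge_eqI by blast
  qed
  show "3 \<le> e mod 10"
    using path_strand_ends_unique[OF edge_cell[OF ef(1)] edge_cell[OF ef(2)] _ _ par] ne
    by force
qed

lemma non_homotopic_theta: "non_homotopic (theta_graph k) (theta_drawing k)"
proof (rule non_homotopicI[OF wf_theta_graph is_drawing_theta])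
  show "x = y" if "e \<in> edges (theta_graph k)" "f \<in> edges (theta_graph k)" "e \<noteq> f"
    "x \<in> edge_inner (theta_drawing k) e \<inter> edge_inner (theta_drawing k) f"
    "y \<in> edge_inner (theta_drawing k) e \<inter> edge_inner (theta_drawing k) f" for e f x y
    using edges_cross_once that by simp
next
  fix e f
  assume "e \<in> edges (theta_graph k)" "f \<in> edges (theta_graph k)" and ne: "e \<noteq> f"
    and "ends (theta_graph k) e = ends (theta_graph k) f"
  then have e: "e < 10 * k" and f: "f < 10 * k"
    and par: "e div 10 \<noteq> f div 10" "3 \<le> e mod 10"
    using parallel_edges[of e f] by auto
  obtain s w where cr: "strands_cross (e mod 10) s w"
    using strands_cross_ex[OF par(2)] by auto
  then have s: "s < 10" "s \<noteq> e mod 10" by (auto elim: strands_crossE)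
  define g where "g = 10 * (e div 10) + s"
  have g: "g div 10 = e div 10" "g mod 10 = s" using s by (auto simp: g_def)
  have "e div 10 < k" using edge_cell[OF e] .
  then have gk: "g < 10 * k" using s(1) by (simp add: g_def)
  have "edge_inner (theta_drawing k) f \<inter> edge_inner (theta_drawing k) g = {}"
    using edge_inner_Int_theta[OF f gk] par(1) g(1) by (metis all_not_in_conv)
  moreover have "edge_inner (theta_drawing k) e \<inter> edge_inner (theta_drawing k) g \<noteq> {}"
    using strands_cross_edge_inner[OF e gk] cr g by auto
  ultimately show "\<exists>g\<in>edges (theta_graph k). g \<noteq> e \<and>
      edge_inner (theta_drawing k) e \<inter> edge_inner (theta_drawing k) g \<noteq> {} \<and>
      edge_inner (theta_drawing k) f \<inter> edge_inner (theta_drawing k) g = {}"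
    using gk s(2) g by (intro bexI[of _ g]) auto
qed

text \<open>An edge is crossed only by edges of its own cell, which are determined by their strand.\<close>

lemma colorable_theta: "colorable_plane 3 1 (theta_graph k) (theta_drawing k)"
  unfolding colorable_plane_def
proof (intro exI[of _ "\<lambda>e. strand_color (e mod 10)"] conjI ballI)
  show "(\<lambda>e. strand_color (e mod 10)) ` edges (theta_graph k) \<subseteq> {1..3}"
    using strand_color_range by (auto simp del: atLeastAtMost_iff)
next
  fix e i assume "e \<in> edges (theta_graph k)"
  then have e: "e < 10 * k" by simp
  let ?F = "{f \<in> edges (theta_graph k). f \<noteq> e \<and> strand_color (f mod 10) = i \<and>
      crossing_points (theta_drawing k) e f \<noteq> {}}"
  have cross: "e div 10 = f div 10 \<and> (\<exists>w. strands_cross (e mod 10) (f mod 10) w)" if F: "f \<in> ?F" for f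
  proof -
    have f: "f < 10 * k" "e \<noteq> f" using F by auto
    obtain x where "x \<in> edge_inner (theta_drawing k) e \<inter> edge_inner (theta_drawing k) f"
      using F edge_inner_Int_eq_crossing_points[OF e f] by auto
    from edge_inner_Int_theta[OF e f this] show ?thesis by blast
  qed
  have "f = g" if F: "f \<in> ?F" "g \<in> ?F" for f g
  proof -
    obtain w w' where "strands_cross (e mod 10) (f mod 10) w" "strands_cross (e mod 10) (g mod 10) w'"
      using cross[OF F(1)] cross[OF F(2)] by blast
    moreover have "strand_color (f mod 10) = strand_color (g mod 10)" using F by simp
    ultimately have "f mod 10 = g mod 10" by (rule strands_crossing_one_strand_differ_in_color)
    moreover have "f div 10 = g div 10" using cross[OF F(1)] cross[OF F(2)] by simp
    ultimately show ?thesis using edge_eqI by blast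
  qed
  then have "\<forall>f\<in>?F. \<forall>g\<in>?F. f = g" by blast
  moreover have "finite ?F" by simp
  ultimately show "card ?F \<le> 1"
    using card_le_Suc0_iff_eq[of ?F] unfolding One_nat_def by blast
qed

lemma crossings_theta:
  "crossings (theta_graph k) (theta_drawing k) =
    (\<lambda>(i, w). roll k (cell_point i w)) ` ({..<k} \<times> (snd \<circ> snd) ` strand_crossings)"
proof (intro equalityI subsetI)
  fix x assume "x \<in> crossings (theta_graph k) (theta_drawing k)"
  then obtain e f where ef: "e < 10 * k" "f < 10 * k" "e \<noteq> f" and "x \<in> crossing_points (theta_drawing k) e f"
    by (auto simp: crossings_def)
  then have "x \<in> edge_inner (theta_drawing k) e \<inter> edge_inner (theta_drawing k) f"
    using edge_inner_Int_eq_crossing_points[OF ef] by simp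
  then obtain w where w: "strands_cross (e mod 10) (f mod 10) w" "x = edge_chart k e w"
    by (rule edge_inner_Int_theta[OF ef])
  have "w \<in> (snd \<circ> snd) ` strand_crossings"
    using w(1) unfolding strands_cross_def by (auto intro: rev_image_eqI)
  moreover have "x = (\<lambda>(i, w). roll k (cell_point i w)) (e div 10, w)" using w(2) by (simp add: edge_chart_def)
  ultimately show "x \<in> (\<lambda>(i, w). roll k (cell_point i w)) ` ({..<k} \<times> (snd \<circ> snd) ` strand_crossings)"
    using edge_cell[OF ef(1)] by blast
next
  fix x assume "x \<in> (\<lambda>(i, w). roll k (cell_point i w)) ` ({..<k} \<times> (snd \<circ> snd) ` strand_crossings)"
  then obtain i t s w where i: "i < k" and "(t, s, w) \<in> strand_crossings" and x: "x = roll k (cell_point i w)"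
    by auto
  then have cr: "strands_cross t s w" by (simp add: strands_cross_def)
  then have ts: "t < 10" "s < 10" "t \<noteq> s" by (auto elim: strands_crossE)
  define e f where "e = 10 * i + t" and "f = 10 * i + s"
  have ef: "e div 10 = i" "e mod 10 = t" "f div 10 = i" "f mod 10 = s" "e < 10 * k" "f < 10 * k" "e \<noteq> f"
    using ts i by (auto simp: e_def f_def)
  have "x \<in> edge_inner (theta_drawing k) e \<inter> edge_inner (theta_drawing k) f"
    using strands_cross_edge_inner[OF ef(5,6), of w] cr ef x by (simp add: edge_chart_def)
  then show "x \<in> crossings (theta_graph k) (theta_drawing k)"
    using edge_inner_Int_eq_crossing_points[OF ef(5-7)] ef(5-7) by (auto simp: crossings_def)
qed

lemma card_crossings_theta: "card (crossings (theta_graph k) (theta_drawing k)) = 8 * k"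
proof -
  have "inj_on (\<lambda>(i, w). roll k (cell_point i w)) ({..<k} \<times> (snd \<circ> snd) ` strand_crossings)"
  proof (rule inj_onI, clarify)
    fix i j t s w t' s' w'
    assume "(t, s, w) \<in> strand_crossings" "(t', s', w') \<in> strand_crossings"
    then have "w \<in> half_open_cell" "w' \<in> half_open_cell"
      by (auto elim!: strand_crossingsE simp: open_cell_def)
    moreover assume "i < k" "j < k"
      "roll k (cell_point i ((snd \<circ> snd) (t, s, w))) = roll k (cell_point j ((snd \<circ> snd) (t', s', w')))"
    ultimately show "i = j \<and> (snd \<circ> snd) (t, s, w) = (snd \<circ> snd) (t', s', w')"
      using roll_half_open_eqD by simp
  qed
  then show ?thesis
    unfolding crossings_theta by (simp only: card_image card_cartesian_product card_strand_crossing_points) simp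
qed

end

theorem proposition3p9:
  fixes n l :: nat
  assumes "n = 6 + 2 * l"
  shows "\<exists>(G :: (nat, nat) multigraph) D.
           wf_multigraph G \<and> is_drawing G D \<and>
           non_homotopic G D \<and> colorable_plane 3 1 G D \<and>
           card (verts G) = n \<and>
           card (edges G) = 5 * (n - 2) \<and>
           card (crossings G D) = 4 * (n - 2)"
proof -
  define k where "k = l + 2"
  have k: "2 \<le> k" by (simp add: k_def)
  show ?thesis
    using wf_theta_graph[OF k] is_drawing_theta[OF k] non_homotopic_theta[OF k] colorable_theta[OF k]
      card_crossings_theta[OF k] assms
    by (intro exI[of _ "theta_graph k"] exI[of _ "theta_drawing k"]) (simp add: k_def)
qed

end
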